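(* Assume that $f_T$ and $f_Y$ are bounded above by a finite constant, $D^2>0$, $\mathsf{E}(T^3)<\infty$, and $\mathsf{E}(Y^3)<\infty$. Then for $t\to\infty$, $$u_{\alpha,t}(c^\ast)=\frac{D}{M^{3/2}}\,\kappa_{\alpha/2}\sqrt t\,\big(1+o(1)\big).$$
   Context: $T_1,T_2,\dots$ are i.i.d. positive random variables distributed as $T$, with density $f_T$; $Y_1,Y_2,\dots$ are i.i.d. positive random variables distributed as $Y$, with density $f_Y$; the two sequences are independent. Renewal process: $N_s=\max\{n\ge 1:\sum_{i=1}^nT_i\le s\}$, with $N_s=0$ if $T_1>s$. Compound renewal process: $V_s=\sum_{i=1}^{N_s}Y_i$, with $V_s=0$ if $T_1>s$. For $u,c\ge 0$, $\Upsilon_{u,c}=\inf\{s>0:V_s-cs>u\}$, with $\Upsilon_{u,c}=+\infty$ if $V_s-cs\le u$ for all $s>0$. Fixed $\alpha\in(0,1/2)$. The fixed-probability level $u_{\alpha,t}(c)$, $c\ge0$, is the solution, with respect to $u\geq 0$, of the equation $\mathsf{P}\{\Upsilon_{u,c}\le t\}=\alpha$. Constants ($\mathsf{D}$ denotes variance): $M=\mathsf{E}T/\mathsf{E}Y$, $c^\ast=M^{-1}=\mathsf{E}Y/\mathsf{E}T$, $D^2=\big((\mathsf{E}T)^2\,\mathsf{D}Y+(\mathsf{E}Y)^2\,\mathsf{D}T\big)/(\mathsf{E}Y)^3$, $D>0$. $\kappa_\beta$ is the upper $\beta$-quantile of the standard normal distribution: $1-\Phi(\kappa_\beta)=\beta$,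 where $\Phi$ is the standard normal c.d.f. *)

theory Defs
  imports "HOL-Probability.Probability" "HOL-Library.Landau_Symbols"
begin

text \<open>
  Sequences are indexed from 0: \<open>T i\<close> and \<open>Y i\<close> stand for the \<open>(i+1)\<close>-st inter-arrival time
  and jump size, and \<open>T 0\<close>, \<open>Y 0\<close> serve as the generic copies of the two distributions.
\<close>

text \<open>
  \<^const>\<open>Max\<close> is meaningful only where the set is finite, that is, off the null event that the
  partial sums of \<open>T\<close> stay bounded by \<open>s\<close>.
\<close>

definition renewal_count :: "(nat \<Rightarrow> 'a \<Rightarrow> real) \<Rightarrow> real \<Rightarrow> 'a \<Rightarrow> nat" where
  "renewal_count T s \<omega> =
     (if T 0 \<omega> > s then 0 else Max {n. n \<ge> 1 \<and> (\<Sum>i<n. T i \<omega>) \<le> s})"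

definition compound_renewal ::
    "(nat \<Rightarrow> 'a \<Rightarrow> real) \<Rightarrow> (nat \<Rightarrow> 'a \<Rightarrow> real) \<Rightarrow> real \<Rightarrow> 'a \<Rightarrow> real" where
  "compound_renewal T Y s \<omega> = (\<Sum>i<renewal_count T s \<omega>. Y i \<omega>)"

text \<open>The infimum is taken in \<^typ>\<open>ereal\<close>, so it is \<open>\<infinity>\<close> when the level is never exceeded.\<close>

definition crossing_time ::
    "(nat \<Rightarrow> 'a \<Rightarrow> real) \<Rightarrow> (nat \<Rightarrow> 'a \<Rightarrow> real) \<Rightarrow> real \<Rightarrow> real \<Rightarrow> 'a \<Rightarrow> ereal" where
  "crossing_time T Y u c \<omega> = Inf (ereal ` {s. s > 0 \<and> compound_renewal T Y s \<omega> - c * s > u})"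

text \<open>
  The equation need not have a unique solution for all \<open>\<alpha>\<close>, \<open>t\<close>, \<open>c\<close>; where it does not, the
  value is unspecified. For \<open>c = E Y / E T\<close> it has one for all large \<open>t\<close> under the moment and
  density assumptions.
\<close>

definition fixed_prob_level ::
    "'a measure \<Rightarrow> (nat \<Rightarrow> 'a \<Rightarrow> real) \<Rightarrow> (nat \<Rightarrow> 'a \<Rightarrow> real) \<Rightarrow> real \<Rightarrow> real \<Rightarrow> real \<Rightarrow> real" where
  "fixed_prob_level \<Omega> T Y \<alpha> t c =
     (THE u. u \<ge> 0 \<and> measure \<Omega> {\<omega> \<in> space \<Omega>. crossing_time T Y u c \<omega> \<le> ereal t} = \<alpha>)"

definition mean_ratio :: "'a measure \<Rightarrow> ('a \<Rightarrow> real) \<Rightarrow> ('a \<Rightarrow> real) \<Rightarrow> real" where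
  "mean_ratio \<Omega> X Z = prob_space.expectation \<Omega> X / prob_space.expectation \<Omega> Z"

definition D_squared :: "'a measure \<Rightarrow> ('a \<Rightarrow> real) \<Rightarrow> ('a \<Rightarrow> real) \<Rightarrow> real" where
  "D_squared \<Omega> X Z =
     ((prob_space.expectation \<Omega> X)\<^sup>2 * prob_space.variance \<Omega> Z
       + (prob_space.expectation \<Omega> Z)\<^sup>2 * prob_space.variance \<Omega> X)
     / (prob_space.expectation \<Omega> Z) ^ 3"

definition normal_upper_quantile :: "real \<Rightarrow> real" where
  "normal_upper_quantile \<beta> = (THE x. 1 - cdf std_normal_distribution x = \<beta>)"

end

theory Submission
  imports Defs "HOL-Real_Asymp.Real_Asymp"
begin

text \<open>
  For \<open>c = E Y / E T\<close> the process \<open>V_s - c s\<close> can exceed \<open>u \<ge> 0\<close> only at renewal epochs, where it equals the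
  centered random walk \<open>S_n\<close> with steps \<open>X_i = Y_i - c T_i\<close>. Hence the crossing probability is, up to a null
  event, the probability that \<open>max S_n > u\<close> over the \<open>n\<close> with \<open>T_1 + \<dots> + T_n \<le> t\<close>. By the weak law of large
  numbers the number of such \<open>n\<close> is about \<open>t / E T\<close>, so the limit law of the maximum of \<open>n\<close> partial sums,
  \<open>P(max > x \<surd>n) \<rightarrow> 2 (1 - \<Phi>(x / \<sigma>))\<close>, locates every solution of the equation defining the level.
  Existence of a solution follows from continuity in \<open>u\<close>, since \<open>S_n\<close> has no atoms. Uniqueness follows because
  the maximum charges every interval of levels of order \<open>\<surd>t\<close>.
\<close>

section \<open>The standard normal distribution\<close>

text \<open>\<open>fixed_prob_level\<close> is a definite description, so nothing is known about its
  value until existence and uniqueness of the solution are both settled. Uniqueness is the delicate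
  half, because nothing is assumed about where the densities are positive: an interval all of whose
  subintervals are charged by the steps has to be extracted from a bare set of positive measure. The
  waiting times must be controlled together with the steps, since the path that separates two levels
  has to reach them before \<open>t\<close> and then stay put until \<open>t\<close>. The joint law
  of \<open>T i\<close> and \<open>X i\<close> is therefore studied, not only the law of
  \<open>X i\<close>. Strictness is obtained only for levels above a constant and below a multiple
  of \<open>t\<close>. This is enough: at \<open>y * sqrt t\<close> and \<open>z * sqrt t\<close>
  the crossing probabilities lie strictly on either side of \<alpha>, so plain monotonicity keeps
  every solution between them, and \<open>sqrt t\<close> is negligible against \<open>t\<close>. The
  factor 2 in the law of the maximum turns \<alpha> into \<open>\<alpha> / 2\<close>, and about
  \<open>t / \<mu>\<close> steps of standard deviation \<sigma> give the constant
  \<open>\<sigma> / sqrt \<mu>\<close>, which is \<open>D / M powr (3 / 2)\<close> in other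
  variables.\<close>

abbreviation normal_tail :: "real \<Rightarrow> real" where
  "normal_tail x \<equiv> 1 - cdf std_normal_distribution x"

interpretation std_normal: real_distribution std_normal_distribution
  by (rule real_dist_normal_dist)

text \<open>The density is strictly positive, so the normal law and Lebesgue measure have the same
  null sets. Absence of atoms and strict growth of the distribution function are both read off from
  this.\<close>

lemma emeasure_std_normal_eq_0_iff:
  assumes "A \<in> sets borel"
  shows "emeasure std_normal_distribution A = 0 \<longleftrightarrow> emeasure lborel A = 0"
proof -
  have "emeasure std_normal_distribution A = 0 \<longleftrightarrow>
      A \<in> null_sets (density lborel (\<lambda>x. ennreal (std_normal_density x)))"
    using assms by (auto simp: null_sets_def)
  also have "\<dots> \<longleftrightarrow> (AE x in lborel. x \<in> A \<longrightarrow> ennreal (std_normal_density x) = 0)"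
    using assms by (subst null_sets_density_iff) auto
  also have "\<dots> \<longleftrightarrow> (AE x in lborel. x \<notin> A)"
    by (intro AE_cong) (simp add: ennreal_eq_0_iff normal_density_pos[of 1 0, simplified not_le[symmetric]])
  also have "\<dots> \<longleftrightarrow> emeasure lborel A = 0"
    using assms by (subst AE_iff_measurable[where N=A]) auto
  finally show ?thesis .
qed

lemma measure_std_normal_singleton: "measure std_normal_distribution {x} = 0"
proof -
  have "emeasure std_normal_distribution {x} = 0"
    by (subst emeasure_std_normal_eq_0_iff) auto
  then show ?thesis by (simp only: measure_def enn2real_0)
qed

lemma isCont_cdf_std_normal: "isCont (cdf std_normal_distribution) x"
  by (simp only: std_normal.isCont_cdf measure_std_normal_singleton)

lemma cdf_std_normal_strict_mono:
  assumes "x < y"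
  shows "cdf std_normal_distribution x < cdf std_normal_distribution y"
proof -
  have "emeasure std_normal_distribution {x<..y} \<noteq> 0"
    using assms by (subst emeasure_std_normal_eq_0_iff) auto
  then have "measure std_normal_distribution {x<..y} > 0"
    by (simp add: std_normal.emeasure_eq_measure zero_less_measure_iff)
  then show ?thesis
    using std_normal.cdf_diff_eq[OF assms] by simp
qed

text \<open>The density is even and Lebesgue measure is invariant under negation. Its purpose is the
  value of the tail at 0.\<close>

lemma std_normal_reflect:
  assumes A: "A \<in> sets borel"
  shows "measure std_normal_distribution (uminus -` A) = measure std_normal_distribution A"
proof -
  have A': "uminus -` A \<in> sets (borel :: real measure)"
    using measurable_sets[OF borel_measurable_uminus[OF measurable_ident_sets[OF refl]] A] by simp
  have "emeasure std_normal_distribution A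
      = (\<integral>\<^sup>+x. ennreal (std_normal_density x) * indicator A x \<partial>distr lborel borel uminus)"
    using A by (subst emeasure_density) (auto simp: lborel_distr_uminus)
  also have "\<dots> = (\<integral>\<^sup>+x. ennreal (std_normal_density (-x)) * indicator A (-x) \<partial>lborel)"
    using A by (subst nn_integral_distr) auto
  also have "\<dots> = (\<integral>\<^sup>+x. ennreal (std_normal_density x) * indicator (uminus -` A) x \<partial>lborel)"
    by (intro nn_integral_cong) (auto simp: normal_density_def indicator_def)
  also have "\<dots> = emeasure std_normal_distribution (uminus -` A)"
    using A' by (subst emeasure_density) auto
  finally show ?thesis by (simp add: measure_def)
qed

lemma normal_tail_0: "normal_tail 0 = 1 / 2"
proof -
  have "cdf std_normal_distribution 0 = measure std_normal_distribution (uminus -` {..0})"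
    by (simp add: cdf_def std_normal_reflect)
  also have "uminus -` {..0} = {0::real..}" by auto
  also have "measure std_normal_distribution {0..} = measure std_normal_distribution {0<..} + measure std_normal_distribution {0}"
    by (subst std_normal.finite_measure_Union[symmetric]) (auto intro!: arg_cong[where f="measure _"])
  also have "measure std_normal_distribution {0} = 0"
    by (rule measure_std_normal_singleton)
  also have "measure std_normal_distribution {0<..} = normal_tail 0"
    using std_normal.prob_compl[of "{..0}"]
    by (simp add: cdf_def Compl_eq_Diff_UNIV[symmetric] Compl_atMost)
  finally show ?thesis by simp
qed

text \<open>The quantile is a definite description: existence comes from the intermediate value
  theorem to the right of 0, uniqueness from strict monotonicity, and the sign from the tail being
  \<open>1 / 2\<close> at 0.\<close>

lemma normal_upper_quantile:
  assumes "0 < \<beta>" "\<beta> < 1 / 2"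
  shows "normal_tail (normal_upper_quantile \<beta>) = \<beta>" "normal_upper_quantile \<beta> > 0"
proof -
  have "eventually (\<lambda>x. cdf std_normal_distribution x > 1 - \<beta>) at_top"
    using std_normal.cdf_lim_at_top_prob assms by (intro order_tendstoD(1)) auto
  then obtain b where b: "\<And>x. x \<ge> b \<Longrightarrow> cdf std_normal_distribution x > 1 - \<beta>"
    by (auto simp: eventually_at_top_linorder)
  have "\<exists>x\<ge>0. x \<le> max b 0 \<and> cdf std_normal_distribution x = 1 - \<beta>"
  proof (rule IVT)
    show "cdf std_normal_distribution 0 \<le> 1 - \<beta>" using normal_tail_0 assms by simp
    show "1 - \<beta> \<le> cdf std_normal_distribution (max b 0)" using b[of "max b 0"] by simp
  qed (use isCont_cdf_std_normal in auto)
  then obtain x where "cdf std_normal_distribution x = 1 - \<beta>" by blast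
  then have x: "normal_tail x = \<beta>" by simp
  have uniq: "y = x" if "normal_tail y = \<beta>" for y
    using that x cdf_std_normal_strict_mono[of x y] cdf_std_normal_strict_mono[of y x]
    by (cases x y rule: linorder_cases) auto
  have eq: "normal_upper_quantile \<beta> = x"
    unfolding normal_upper_quantile_def by (rule the_equality, rule x, rule uniq)
  show "normal_tail (normal_upper_quantile \<beta>) = \<beta>" using eq x by simp
  have "x > 0"
  proof (rule ccontr)
    assume "\<not> x > 0"
    then have "cdf std_normal_distribution x \<le> cdf std_normal_distribution 0"
      by (intro std_normal.cdf_nondecreasing) auto
    then show False using x assms normal_tail_0 by simp
  qed
  then show "normal_upper_quantile \<beta> > 0" using eq by simp
qed

section \<open>Maxima of sums of i.i.d. variables\<close>

text \<open>The value space is left open because the locale serves real steps as well as the pairs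
  \<open>(T i, Y i)\<close>.\<close>

locale iid_sequence = prob_space +
  fixes X :: "nat \<Rightarrow> 'a \<Rightarrow> 'b" and N :: "'b measure"
  assumes indep: "indep_vars (\<lambda>_. N) X UNIV"
    and identical: "distr M N (X i) = distr M N (X 0)"
begin

lemma measurable_X [measurable]: "X i \<in> measurable M N"
  using indep by (auto simp: indep_vars_def2)

lemma iid_sequence_compose:
  assumes f: "f \<in> measurable N N'"
  shows "iid_sequence M (\<lambda>i \<omega>. f (X i \<omega>)) N'"
proof
  show "indep_vars (\<lambda>_. N') (\<lambda>i \<omega>. f (X i \<omega>)) UNIV"
    by (rule indep_vars_compose2[OF indep]) (rule f)
  show "distr M N' (\<lambda>\<omega>. f (X i \<omega>)) = distr M N' (\<lambda>\<omega>. f (X 0 \<omega>))" for i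
    using distr_distr[OF f measurable_X[of i]] distr_distr[OF f measurable_X[of 0]] identical[of i]
    by (simp add: comp_def)
qed

lemma indep_vars_shift: "indep_vars (\<lambda>_. N) (\<lambda>i. X (k + i)) I"
proof -
  \<comment> \<open>Reindexing is expressed as grouping into the singleton blocks
    \<open>{k + j}\<close>.\<close>
  have "indep_vars (\<lambda>j. PiM {k + j} (\<lambda>_. N)) (\<lambda>j \<omega>. restrict (\<lambda>i. X i \<omega>) {k + j}) I"
    by (rule indep_vars_restrict[OF indep]) (auto simp: disjoint_family_on_def)
  then have "indep_vars (\<lambda>_. N) (\<lambda>j \<omega>. (\<lambda>f. f (k + j)) (restrict (\<lambda>i. X i \<omega>) {k + j})) I"
    by (rule indep_vars_compose2) auto
  then show ?thesis by simp
qed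

text \<open>By independence the joint law of a block is the product of its marginals, and these do
  not depend on the index. The empty block is separate because the product characterization is
  applied to nonempty index sets.\<close>

lemma distr_block_shift:
  "distr M (\<Pi>\<^sub>M i\<in>{..<m}. N) (\<lambda>\<omega>. \<lambda>i\<in>{..<m}. X (k + i) \<omega>)
    = distr M (\<Pi>\<^sub>M i\<in>{..<m}. N) (\<lambda>\<omega>. \<lambda>i\<in>{..<m}. X i \<omega>)"
proof (cases "m = 0")
  case True
  then show ?thesis by (auto intro!: distr_cong simp: restrict_def)
next
  case False
  have "distr M (\<Pi>\<^sub>M i\<in>{..<m}. N) (\<lambda>\<omega>. \<lambda>i\<in>{..<m}. X (j + i) \<omega>)
      = (\<Pi>\<^sub>M i\<in>{..<m}. distr M N (X (j + i)))" for j
    using False indep_vars_iff_distr_eq_PiM'[of "{..<m}" "\<lambda>i. X (j + i)" "\<lambda>_. N"] indep_vars_shift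
    by auto
  note eq = this[of k] this[of 0]
  have "(\<lambda>i. distr M N (X (k + i))) = (\<lambda>i. distr M N (X i))"
    using identical by metis
  with eq show ?thesis by (simp only: add_0)
qed

lemma prob_eq:
  assumes "A \<in> sets N"
  shows "prob {\<omega>\<in>space M. X i \<omega> \<in> A} = prob {\<omega>\<in>space M. X 0 \<omega> \<in> A}"
proof -
  have "prob {\<omega>\<in>space M. X i \<omega> \<in> A} = measure (distr M N (X i)) A" for i
    using assms by (subst measure_distr) (auto intro!: arg_cong[where f=prob])
  then show ?thesis using identical by metis
qed

end

locale iid_real = iid_sequence M X "borel :: real measure" for M and X
begin

lemma prob_sum_shift:
  assumes B: "B \<in> sets borel"
  shows "prob {\<omega>\<in>space M. (\<Sum>i=k..<k+m. X i \<omega>) \<in> B} = prob {\<omega>\<in>space M. (\<Sum>i<m. X i \<omega>) \<in> B}"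
proof -
  let ?P = "\<Pi>\<^sub>M i\<in>{..<m}. (borel :: real measure)"
  have "prob {\<omega>\<in>space M. (\<Sum>i=j..<j+m. X i \<omega>) \<in> B}
      = measure (distr M ?P (\<lambda>\<omega>. \<lambda>i\<in>{..<m}. X (j + i) \<omega>)) {f\<in>space ?P. (\<Sum>i<m. f i) \<in> B}" for j
  proof -
    have 1: "(\<Sum>i=j..<j+m. X i \<omega>) = (\<Sum>i<m. X (j + i) \<omega>)" for \<omega>
      using sum.shift_bounds_nat_ivl[of "\<lambda>i. X i \<omega>" 0 j m] by (simp add: atLeast0LessThan add.commute)
    show ?thesis
      using B by (subst measure_distr) (auto intro!: arg_cong[where f=prob] simp: 1 space_PiM)
  qed
  from this[of k] this[of 0] show ?thesis
    using distr_block_shift[of m k] by (simp add: atLeast0LessThan)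
qed

text \<open>The Markov property in the only form needed: the past of length \<open>k\<close> is
  independent of the next \<open>m\<close> steps, whose sum has the law of
  \<open>S m\<close>.\<close>

lemma prob_prefix_block:
  assumes P: "Measurable.pred (\<Pi>\<^sub>M i\<in>{..<k}. borel) P" and B: "B \<in> sets borel"
  shows "prob {\<omega>\<in>space M. P (\<lambda>i\<in>{..<k}. X i \<omega>) \<and> (\<Sum>i=k..<k+m. X i \<omega>) \<in> B}
    = prob {\<omega>\<in>space M. P (\<lambda>i\<in>{..<k}. X i \<omega>)} * prob {\<omega>\<in>space M. (\<Sum>i<m. X i \<omega>) \<in> B}"
proof -
  let ?X = "\<lambda>\<omega>. \<lambda>i\<in>{..<k}. X i \<omega>" and ?Z = "\<lambda>\<omega>. \<lambda>i\<in>{k..<k+m}. X i \<omega>"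
  have ind: "indep_var (\<Pi>\<^sub>M i\<in>{..<k}. borel) ?X (\<Pi>\<^sub>M i\<in>{k..<k+m}. borel) ?Z"
    by (rule indep_var_restrict[OF indep]) auto
  have "prob ((\<lambda>x. (?X x, ?Z x)) -` ({f\<in>space (\<Pi>\<^sub>M i\<in>{..<k}. borel). P f}
          \<times> {f\<in>space (\<Pi>\<^sub>M i\<in>{k..<k+m}. borel). (\<Sum>i=k..<k+m. f i) \<in> B}) \<inter> space M)
      = prob (?X -` {f\<in>space (\<Pi>\<^sub>M i\<in>{..<k}. borel). P f} \<inter> space M)
      * prob (?Z -` {f\<in>space (\<Pi>\<^sub>M i\<in>{k..<k+m}. borel). (\<Sum>i=k..<k+m. f i) \<in> B} \<inter> space M)"
    by (rule indep_varD[OF ind]) (use P B in measurable)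
  then show ?thesis
    by (subst prob_sum_shift[OF B, of k, symmetric])
       (auto simp: space_PiM vimage_def Int_def conj_commute)
qed

abbreviation S :: "nat \<Rightarrow> 'a \<Rightarrow> real" where
  "S n \<omega> \<equiv> \<Sum>i<n. X i \<omega>"

definition first_passage :: "real \<Rightarrow> nat \<Rightarrow> 'a set" where
  "first_passage a k = {\<omega>\<in>space M. S k \<omega> > a \<and> (\<forall>j<k. S j \<omega> \<le> a)}"

definition exceeds :: "nat \<Rightarrow> real \<Rightarrow> 'a set" where
  "exceeds n a = {\<omega>\<in>space M. \<exists>k\<in>{1..n}. S k \<omega> > a}"

lemma sets_first_passage [measurable]: "first_passage a k \<in> sets M"
  unfolding first_passage_def by measurable

lemma sets_exceeds [measurable]: "exceeds n a \<in> sets M"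
  unfolding exceeds_def by measurable

lemma disjoint_first_passage: "disjoint_family (first_passage a)"
proof -
  have "first_passage a m \<inter> first_passage a n = {}" if "m \<noteq> n" for m n
    using that by (cases m n rule: linorder_cases) (auto simp: first_passage_def not_le[symmetric])
  then show ?thesis by (auto simp: disjoint_family_on_def)
qed

lemma exceeds_eq:
  assumes "a \<ge> 0"
  shows "exceeds n a = (\<Union>k\<in>{1..n}. first_passage a k)"
proof (intro equalityI subsetI)
  fix \<omega> assume \<omega>: "\<omega> \<in> exceeds n a"
  then obtain k where k: "k \<in> {1..n}" "S k \<omega> > a" by (auto simp: exceeds_def)
  define l where "l = (LEAST k. S k \<omega> > a)"
  have l: "S l \<omega> > a" "l \<le> k" unfolding l_def using k by (auto intro: LeastI Least_le)
  \<comment> \<open>Since \<open>S 0\<close> is 0, a level \<open>a \<ge> 0\<close> cannot be passed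
    at index 0.\<close>
  have "l \<ge> 1" using l(1) assms by (cases l) auto
  moreover have "S j \<omega> \<le> a" if "j < l" for j
    using not_less_Least[of j "\<lambda>k. S k \<omega> > a"] that by (auto simp: l_def not_less)
  ultimately show "\<omega> \<in> (\<Union>k\<in>{1..n}. first_passage a k)"
    using k l \<omega> by (auto simp: first_passage_def exceeds_def intro!: bexI[of _ l])
qed (auto simp: first_passage_def exceeds_def)

text \<open>First passage at \<open>k\<close> depends on the first \<open>k\<close> steps only, and
  the later increment \<open>S n - S k\<close> is independent of them with the law of
  \<open>S (n - k)\<close>.\<close>

lemma prob_first_passage_later:
  assumes "k \<le> n"
  shows "prob {\<omega>\<in>first_passage a k. S n \<omega> > S k \<omega>} = prob (first_passage a k) * prob {\<omega>\<in>space M. S (n - k) \<omega> > 0}"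
proof -
  \<comment> \<open>With \<open>min j k\<close> the sum reads only coordinates below
    \<open>k\<close> for every \<open>j\<close>, so it is measurable without a side condition on
    \<open>j\<close>; for \<open>j < k\<close> nothing changes.\<close>
  let ?P = "\<lambda>f :: nat \<Rightarrow> real. (\<Sum>i<k. f i) > a \<and> (\<forall>j<k. (\<Sum>i<min j k. f i) \<le> a)"
  have *: "Measurable.pred (\<Pi>\<^sub>M i\<in>{..<k}. borel) ?P"
  proof -
    have [measurable]: "(\<lambda>f. \<Sum>i<min j k. f i) \<in> borel_measurable (\<Pi>\<^sub>M i\<in>{..<k}. (borel :: real measure))" for j
      by (intro borel_measurable_sum measurable_component_singleton) auto
    have [measurable]: "(\<lambda>f. \<Sum>i<k. f i) \<in> borel_measurable (\<Pi>\<^sub>M i\<in>{..<k}. (borel :: real measure))"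
      by (intro borel_measurable_sum measurable_component_singleton) auto
    show ?thesis by measurable
  qed
  have P: "?P (\<lambda>i\<in>{..<k}. X i \<omega>) \<longleftrightarrow> S k \<omega> > a \<and> (\<forall>j<k. S j \<omega> \<le> a)" for \<omega>
  proof -
    have "(\<Sum>i<j. (\<lambda>i\<in>{..<k}. X i \<omega>) i) = S j \<omega>" if "j \<le> k" for j
      using that by (intro sum.cong) auto
    then show ?thesis by simp
  qed
  have diff: "S n \<omega> = S k \<omega> + (\<Sum>i=k..<n. X i \<omega>)" for \<omega>
    using sum.atLeastLessThan_concat[of 0 k n "\<lambda>i. X i \<omega>"] assms by (simp add: atLeast0LessThan)
  have "prob {\<omega>\<in>space M. ?P (\<lambda>i\<in>{..<k}. X i \<omega>) \<and> (\<Sum>i=k..<k+(n-k). X i \<omega>) \<in> {0<..}}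
    = prob {\<omega>\<in>space M. ?P (\<lambda>i\<in>{..<k}. X i \<omega>)} * prob {\<omega>\<in>space M. S (n - k) \<omega> \<in> {0<..}}"
    by (rule prob_prefix_block[OF *]) auto
  moreover have "{\<omega>\<in>space M. ?P (\<lambda>i\<in>{..<k}. X i \<omega>)} = first_passage a k"
    unfolding P first_passage_def ..
  moreover have "{\<omega>\<in>space M. ?P (\<lambda>i\<in>{..<k}. X i \<omega>) \<and> (\<Sum>i=k..<k+(n-k). X i \<omega>) \<in> {0<..}}
      = {\<omega>\<in>first_passage a k. S n \<omega> > S k \<omega>}"
    unfolding P first_passage_def using assms by (auto simp: diff)
  ultimately show ?thesis by simp
qed

lemma sum_prob_first_passage:
  assumes "a \<ge> 0"
  shows "(\<Sum>k\<in>{1..n}. prob (first_passage a k)) = prob (exceeds n a)"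
  unfolding exceeds_eq[OF assms]
  by (subst finite_measure_finite_Union) (use disjoint_first_passage in \<open>auto intro: disjoint_family_on_mono\<close>)

lemma sum_prob_first_passage_later:
  assumes "a \<ge> 0"
  shows "(\<Sum>k\<in>{1..n}. prob {\<omega>\<in>first_passage a k. S m \<omega> > S k \<omega>})
    = prob {\<omega>\<in>space M. \<exists>k\<in>{1..n}. \<omega> \<in> first_passage a k \<and> S m \<omega> > S k \<omega>}"
proof -
  have sets: "{\<omega>\<in>first_passage a k. S m \<omega> > S k \<omega>} \<in> sets M" for k
  proof -
    have "{\<omega>\<in>first_passage a k. S m \<omega> > S k \<omega>} = first_passage a k \<inter> {\<omega>\<in>space M. S m \<omega> > S k \<omega>}"
      by (auto simp: first_passage_def)
    then show ?thesis by simp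
  qed
  have "disjoint_family_on (\<lambda>k. {\<omega>\<in>first_passage a k. S m \<omega> > S k \<omega>}) {1..n}"
    using disjoint_first_passage by (fastforce simp: disjoint_family_on_def)
  then have "(\<Sum>k\<in>{1..n}. prob {\<omega>\<in>first_passage a k. S m \<omega> > S k \<omega>})
     = prob (\<Union>k\<in>{1..n}. {\<omega>\<in>first_passage a k. S m \<omega> > S k \<omega>})"
    using sets by (subst finite_measure_finite_Union) auto
  also have "(\<Union>k\<in>{1..n}. {\<omega>\<in>first_passage a k. S m \<omega> > S k \<omega>})
     = {\<omega>\<in>space M. \<exists>k\<in>{1..n}. \<omega> \<in> first_passage a k \<and> S m \<omega> > S k \<omega>}"
    by (auto simp: first_passage_def)
  finally show ?thesis .
qed

text \<open>Once the level is passed at some \<open>k \<le> n\<close>, at least \<open>m0\<close>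
  steps remain until time \<open>n + m0\<close>, and with probability at least \<open>p\<close> the
  walk then stands above its position at the passage, hence above \<open>a\<close>. The delay
  \<open>m0\<close> is there because the central limit theorem controls only long
  increments.\<close>

lemma prob_exceeds_upper:
  assumes "a \<ge> 0" and p: "\<And>m. m \<ge> m0 \<Longrightarrow> p \<le> prob {\<omega>\<in>space M. S m \<omega> > 0}"
  shows "p * prob (exceeds n a) \<le> prob {\<omega>\<in>space M. S (n + m0) \<omega> > a}"
proof -
  have "p * prob (exceeds n a) = (\<Sum>k\<in>{1..n}. prob (first_passage a k) * p)"
    by (simp add: sum_prob_first_passage[OF assms(1), symmetric] sum_distrib_left mult.commute del: One_nat_def)
  also have "\<dots> \<le> (\<Sum>k\<in>{1..n}. prob (first_passage a k) * prob {\<omega>\<in>space M. S (n + m0 - k) \<omega> > 0})"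
    by (intro sum_mono mult_left_mono p) auto
  also have "\<dots> = (\<Sum>k\<in>{1..n}. prob {\<omega>\<in>first_passage a k. S (n + m0) \<omega> > S k \<omega>})"
    by (intro sum.cong prob_first_passage_later[symmetric]) auto
  also have "\<dots> = prob {\<omega>\<in>space M. \<exists>k\<in>{1..n}. \<omega> \<in> first_passage a k \<and> S (n + m0) \<omega> > S k \<omega>}"
    by (rule sum_prob_first_passage_later[OF assms(1)])
  also have "\<dots> \<le> prob {\<omega>\<in>space M. S (n + m0) \<omega> > a}"
    by (rule finite_measure_mono) (auto simp: first_passage_def)
  finally show ?thesis .
qed

text \<open>The converse estimate has to bound the overshoot at the passage. If no step exceeds
  \<delta>, the walk is at most \<open>a + \<delta>\<close> when it passes the level. The second
  \<delta> covers the last \<open>m0\<close> steps, so that a passage by time \<open>n - m0\<close>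
  can be assumed and a long increment is left over.\<close>

lemma prob_exceeds_lower:
  assumes "a \<ge> 0" "\<delta> > 0" "m0 \<le> n" and q: "\<And>m. m \<ge> m0 \<Longrightarrow> prob {\<omega>\<in>space M. S m \<omega> > 0} \<le> q"
  shows "prob {\<omega>\<in>space M. S n \<omega> > a + 2 * \<delta>}
    \<le> q * prob (exceeds n a) + (n * prob {\<omega>\<in>space M. X 0 \<omega> > \<delta>} + prob {\<omega>\<in>space M. S m0 \<omega> > \<delta>})"
proof -
  have q0: "q \<ge> 0" using q[of m0] measure_nonneg[of M] by (meson order.trans order_refl)
  let ?E1 = "{\<omega>\<in>space M. \<exists>k\<in>{1..n-m0}. \<omega> \<in> first_passage a k \<and> S n \<omega> > S k \<omega>}"
  let ?E2 = "\<Union>i<n. {\<omega>\<in>space M. X i \<omega> > \<delta>}"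
  let ?E3 = "{\<omega>\<in>space M. (\<Sum>i=n-m0..<n. X i \<omega>) > \<delta>}"
  have sub: "{\<omega>\<in>space M. S n \<omega> > a + 2 * \<delta>} \<subseteq> ?E1 \<union> (?E2 \<union> ?E3)"
  proof (intro subsetI, rule ccontr)
    fix \<omega> assume "\<omega> \<in> {\<omega>\<in>space M. S n \<omega> > a + 2 * \<delta>}" and out: "\<omega> \<notin> ?E1 \<union> (?E2 \<union> ?E3)"
    then have \<omega>: "\<omega> \<in> space M" "S n \<omega> > a + 2 * \<delta>" "\<omega> \<notin> ?E2"
      "\<not> (\<Sum>i=n-m0..<n. X i \<omega>) > \<delta>" by auto
    have "S n \<omega> = S (n - m0) \<omega> + (\<Sum>i=n-m0..<n. X i \<omega>)"
      using sum.atLeastLessThan_concat[of 0 "n-m0" n "\<lambda>i. X i \<omega>"] by (simp add: atLeast0LessThan)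
    then have gt: "S (n - m0) \<omega> > a" using \<omega> assms by simp
    then have "n - m0 \<ge> 1" using assms(1) by (cases "n - m0") auto
    then have "\<omega> \<in> exceeds (n - m0) a" using gt \<omega> by (auto simp: exceeds_def)
    then obtain k where k: "k \<in> {1..n-m0}" "\<omega> \<in> first_passage a k" by (auto simp: exceeds_eq[OF assms(1)])
    then obtain j where j: "k = Suc j" by (cases k) auto
    have "S j \<omega> \<le> a" "X j \<omega> \<le> \<delta>" using k j \<omega> by (auto simp: first_passage_def not_less)
    then have "S k \<omega> \<le> a + \<delta>" by (simp add: j)
    then have "S n \<omega> > S k \<omega>" using \<omega> assms by simp
    then show False using k \<omega> out by auto
  qed
  have "prob {\<omega>\<in>space M. S n \<omega> > a + 2 * \<delta>} \<le> prob (?E1 \<union> (?E2 \<union> ?E3))"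
    by (rule finite_measure_mono[OF sub]) measurable
  also have "\<dots> \<le> prob ?E1 + prob (?E2 \<union> ?E3)"
    by (rule measure_Un_le) measurable
  also have "prob (?E2 \<union> ?E3) \<le> prob ?E2 + prob ?E3"
    by (rule measure_Un_le) measurable
  also have "prob ?E2 \<le> (\<Sum>i<n. prob {\<omega>\<in>space M. X i \<omega> > \<delta>})"
    by (rule finite_measure_subadditive_finite) auto
  also have "\<dots> = (\<Sum>i<n. prob {\<omega>\<in>space M. X 0 \<omega> > \<delta>})"
    by (rule sum.cong[OF refl]) (rule prob_eq[of "{\<delta><..}", simplified])
  also have "\<dots> = n * prob {\<omega>\<in>space M. X 0 \<omega> > \<delta>}"
    by simp
  also have "prob ?E3 = prob {\<omega>\<in>space M. S m0 \<omega> > \<delta>}"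
    using prob_sum_shift[of "{\<delta><..}" "n - m0" m0] assms by simp
  also have "prob ?E1 = (\<Sum>k\<in>{1..n-m0}. prob {\<omega>\<in>first_passage a k. S n \<omega> > S k \<omega>})"
    by (rule sum_prob_first_passage_later[OF assms(1), symmetric])
  also have "\<dots> = (\<Sum>k\<in>{1..n-m0}. prob (first_passage a k) * prob {\<omega>\<in>space M. S (n - k) \<omega> > 0})"
    by (intro sum.cong prob_first_passage_later) auto
  also have "\<dots> \<le> (\<Sum>k\<in>{1..n-m0}. prob (first_passage a k) * q)"
    using assms(3) by (intro sum_mono mult_left_mono q) auto
  also have "\<dots> = q * prob (exceeds (n - m0) a)"
    by (simp add: sum_prob_first_passage[OF assms(1), symmetric] sum_distrib_left mult.commute del: One_nat_def)
  also have "\<dots> \<le> q * prob (exceeds n a)"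
    using q0 by (intro mult_left_mono finite_measure_mono) (force simp: exceeds_def)+
  finally show ?thesis by simp
qed

end

lemma (in prob_space) tendsto_prob_gt_at_top:
  fixes Z :: "'a \<Rightarrow> real"
  assumes [measurable]: "Z \<in> borel_measurable M"
  shows "((\<lambda>r. prob {\<omega>\<in>space M. Z \<omega> > r}) \<longlongrightarrow> 0) at_top"
proof -
  interpret D: prob_space "distr M borel Z" by (rule prob_space_distr) simp
  interpret D: real_distribution "distr M borel Z" by unfold_locales simp
  have eq: "prob {\<omega>\<in>space M. Z \<omega> > r} = 1 - cdf (distr M borel Z) r" for r
  proof -
    have "cdf (distr M borel Z) r = prob {\<omega>\<in>space M. Z \<omega> \<le> r}"
      by (subst cdf_def, subst measure_distr) (auto intro!: arg_cong[where f=prob])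
    moreover have "prob {\<omega>\<in>space M. \<not> Z \<omega> \<le> r} = 1 - prob {\<omega>\<in>space M. Z \<omega> \<le> r}"
      by (rule prob_neg) simp
    ultimately show ?thesis by (simp add: not_le)
  qed
  have "((\<lambda>r. 1 - cdf (distr M borel Z) r) \<longlongrightarrow> 1 - 1) at_top"
    by (intro tendsto_intros D.cdf_lim_at_top_prob)
  then show ?thesis by (simp add: eq)
qed

section \<open>Limit laws of centered sums and of their running maximum\<close>

locale centered_iid = iid_real +
  fixes \<sigma> :: real
  assumes mean: "expectation (X 0) = 0"
    and sigma_pos: "\<sigma> > 0"
    and integrable_square: "integrable M (\<lambda>\<omega>. (X 0 \<omega>)\<^sup>2)"
    and variance: "expectation (\<lambda>\<omega>. (X 0 \<omega>)\<^sup>2) = \<sigma>\<^sup>2"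
    and integrable_cube: "integrable M (\<lambda>\<omega>. \<bar>X 0 \<omega>\<bar> ^ 3)"
begin

lemma expectation_eq:
  fixes g :: "real \<Rightarrow> real"
  assumes [measurable]: "g \<in> borel_measurable borel"
  shows "expectation (\<lambda>\<omega>. g (X i \<omega>)) = expectation (\<lambda>\<omega>. g (X 0 \<omega>))"
    and "integrable M (\<lambda>\<omega>. g (X i \<omega>)) \<longleftrightarrow> integrable M (\<lambda>\<omega>. g (X 0 \<omega>))"
proof -
  have "expectation (\<lambda>\<omega>. g (X i \<omega>)) = (\<integral>x. g x \<partial>distr M borel (X i))" for i
    by (subst integral_distr) auto
  from this[of i] this[of 0] show "expectation (\<lambda>\<omega>. g (X i \<omega>)) = expectation (\<lambda>\<omega>. g (X 0 \<omega>))"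
    using identical[of i] by simp
  have "integrable M (\<lambda>\<omega>. g (X i \<omega>)) \<longleftrightarrow> integrable (distr M borel (X i)) g" for i
    by (subst integrable_distr_eq) auto
  from this[of i] this[of 0] show "integrable M (\<lambda>\<omega>. g (X i \<omega>)) \<longleftrightarrow> integrable M (\<lambda>\<omega>. g (X 0 \<omega>))"
    using identical[of i] by simp
qed

text \<open>The central limit theorem in tail form; it holds at every \<open>x\<close> because the
  limiting distribution function is continuous everywhere.\<close>

lemma prob_sum_tendsto:
  "(\<lambda>n. prob {\<omega>\<in>space M. S n \<omega> > x * sqrt n}) \<longlonglongrightarrow> normal_tail (x / \<sigma>)"
proof -
  have "weak_conv_m (\<lambda>n. distr M borel (\<lambda>\<omega>. (\<Sum>i<n. X i \<omega> - 0) / sqrt (n * \<sigma>\<^sup>2))) std_normal_distribution"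
  proof (rule central_limit_theorem[OF indep])
    show "expectation (X n) = 0" for n
      using expectation_eq(1)[of "\<lambda>x. x" n] mean by simp
    show "integrable M (\<lambda>\<omega>. (X n \<omega>)\<^sup>2)" for n
      using expectation_eq(2)[of "\<lambda>x. x\<^sup>2" n] integrable_square by simp
    show "variance (X n) = \<sigma>\<^sup>2" for n
      using expectation_eq(1)[of "\<lambda>x. x" n] expectation_eq(1)[of "\<lambda>x. x\<^sup>2" n] mean variance by simp
    show "distr M borel (X n) = distr M borel (X 0)" for n
      by (rule identical)
  qed (rule sigma_pos)
  then have "(\<lambda>n. cdf (distr M borel (\<lambda>\<omega>. S n \<omega> / sqrt (n * \<sigma>\<^sup>2))) (x / \<sigma>)) \<longlonglongrightarrow> cdf std_normal_distribution (x / \<sigma>)"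
    using isCont_cdf_std_normal by (simp add: weak_conv_m_def weak_conv_def)
  then have "(\<lambda>n. 1 - cdf (distr M borel (\<lambda>\<omega>. S n \<omega> / sqrt (n * \<sigma>\<^sup>2))) (x / \<sigma>)) \<longlonglongrightarrow> normal_tail (x / \<sigma>)"
    by (intro tendsto_intros)
  moreover have "eventually (\<lambda>n. 1 - cdf (distr M borel (\<lambda>\<omega>. S n \<omega> / sqrt (n * \<sigma>\<^sup>2))) (x / \<sigma>)
      = prob {\<omega>\<in>space M. S n \<omega> > x * sqrt n}) sequentially"
    using eventually_gt_at_top[of 0]
  proof eventually_elim
    case (elim n)
    have *: "S n \<omega> / sqrt (n * \<sigma>\<^sup>2) \<le> x / \<sigma> \<longleftrightarrow> S n \<omega> \<le> x * sqrt n" for \<omega>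
      using elim sigma_pos by (simp add: real_sqrt_mult field_simps)
    have "cdf (distr M borel (\<lambda>\<omega>. S n \<omega> / sqrt (n * \<sigma>\<^sup>2))) (x / \<sigma>) = prob {\<omega>\<in>space M. S n \<omega> \<le> x * sqrt n}"
      by (subst cdf_def, subst measure_distr) (auto intro!: arg_cong[where f=prob] simp: *[simplified])
    moreover have "prob {\<omega>\<in>space M. \<not> S n \<omega> \<le> x * sqrt n} = 1 - prob {\<omega>\<in>space M. S n \<omega> \<le> x * sqrt n}"
      by (rule prob_neg) simp
    ultimately show ?case by (simp add: not_le)
  qed
  ultimately show ?thesis by (rule Lim_transform_eventually)
qed

lemma prob_sum_pos_tendsto: "(\<lambda>n. prob {\<omega>\<in>space M. S n \<omega> > 0}) \<longlonglongrightarrow> 1 / 2"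
  using prob_sum_tendsto[of 0] normal_tail_0 by simp

lemma prob_sum_gt_sqrt_tendsto_0:
  assumes "d > 0"
  shows "(\<lambda>n. prob {\<omega>\<in>space M. S m \<omega> > d * sqrt n}) \<longlonglongrightarrow> 0"
proof -
  have "filterlim (\<lambda>n :: nat. d * sqrt n) at_top sequentially"
    using assms by real_asymp
  from filterlim_compose[OF tendsto_prob_gt_at_top this, of "S m"] show ?thesis by simp
qed

text \<open>Bounds the chance that one of \<open>n\<close> steps exceeds \<open>d * sqrt n\<close>,
  the overshoot term of the lower estimate. Markov's inequality for the third absolute moment leaves
  a factor \<open>1 / sqrt n\<close>.\<close>

lemma prob_jump_tendsto_0:
  assumes "d > 0"
  shows "(\<lambda>n. n * prob {\<omega>\<in>space M. X 0 \<omega> > d * sqrt n}) \<longlonglongrightarrow> 0"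
proof -
  let ?C = "expectation (\<lambda>\<omega>. \<bar>X 0 \<omega>\<bar> ^ 3)"
  have "(\<lambda>n. 1 / sqrt (real n)) \<longlonglongrightarrow> 0"
    by real_asymp
  from tendsto_mult_right_zero[OF this, of "?C / d ^ 3"]
 have lim: "(\<lambda>n. ?C / (d ^ 3 * sqrt n)) \<longlonglongrightarrow> 0"
    by simp
  have le: "eventually (\<lambda>n. n * prob {\<omega>\<in>space M. X 0 \<omega> > d * sqrt n} \<le> ?C / (d ^ 3 * sqrt n)) sequentially"
    using eventually_gt_at_top[of 0]
  proof eventually_elim
    case (elim n)
    have pos: "d * sqrt n > 0" using elim assms by simp
    have "prob {\<omega>\<in>space M. X 0 \<omega> > d * sqrt n} \<le> prob {\<omega>\<in>space M. \<bar>X 0 \<omega>\<bar> ^ 3 \<ge> (d * sqrt n) ^ 3}"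
      using pos by (intro finite_measure_mono) (auto intro!: power_mono)
    also have "\<dots> \<le> ?C / (d * sqrt n) ^ 3"
      by (rule integral_Markov_inequality_measure[where A="{}"]) (use pos integrable_cube in auto)
    finally have "n * prob {\<omega>\<in>space M. X 0 \<omega> > d * sqrt n} \<le> n * (?C / (d * sqrt n) ^ 3)"
      by (intro mult_left_mono) auto
    also have "\<dots> = ?C / (d ^ 3 * sqrt n)"
      using elim assms by (simp add: power_mult_distrib power3_eq_cube field_simps)
    finally show ?case .
  qed
  show ?thesis
    by (rule tendsto_sandwich[OF _ le tendsto_const lim]) simp
qed

text \<open>Here \<open>c\<close> is an arbitrary slope. It is used with -1 and 2, the slack in the
  level that the upper and the lower estimate cost.\<close>

lemma isCont_normal_tail_shift: "((\<lambda>d. normal_tail ((x + c * d) / \<sigma>)) \<longlongrightarrow> normal_tail (x / \<sigma>)) (at_right 0)"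
proof -
  have "((\<lambda>d. (x + c * d) / \<sigma>) \<longlongrightarrow> (x + c * 0) / \<sigma>) (at_right 0)"
    by (intro tendsto_intros) (use sigma_pos in auto)
  then have "((\<lambda>d. cdf std_normal_distribution ((x + c * d) / \<sigma>)) \<longlongrightarrow> cdf std_normal_distribution (x / \<sigma>)) (at_right 0)"
    by (intro isCont_tendsto_compose[OF isCont_cdf_std_normal]) simp
  then show ?thesis by (intro tendsto_intros)
qed

text \<open>The Erdos--Kac theorem for the running maximum. The reflection argument needs no symmetry of the
  steps: by the central limit theorem a walk that has just crossed the level is above
  its position at the crossing with probability close to \<open>1/2\<close> at any much later time.\<close>

theorem prob_exceeds_tendsto:
  assumes x: "x \<ge> 0"
  shows "(\<lambda>n. prob (exceeds n (x * sqrt n))) \<longlonglongrightarrow> 2 * normal_tail (x / \<sigma>)"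
proof (rule order_tendstoI)
  fix L assume L: "2 * normal_tail (x / \<sigma>) < L"
  have "L > 0"
    using L std_normal.cdf_bounded_prob[of "x / \<sigma>"] by simp
  have "eventually (\<lambda>d. normal_tail ((x + (-1) * d) / \<sigma>) < L / 2) (at_right 0)"
    by (rule order_tendstoD(2)[OF isCont_normal_tail_shift]) (use L in simp)
  then have "eventually (\<lambda>d. d > 0 \<and> normal_tail ((x + (-1) * d) / \<sigma>) < L / 2) (at_right 0)"
    by (intro eventually_conj) (auto simp: eventually_at_right_less)
  then obtain d where d: "d > 0" "normal_tail ((x - d) / \<sigma>) < L / 2"
    using eventually_happens'[OF trivial_limit_at_right_real] by force
  \<comment> \<open>The slack between the tail and \<open>L / 2\<close> leaves room for a
    \<open>p\<close> strictly below the limit \<open>1 / 2\<close> of \<open>P(S m > 0)\<close>. The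
    witness makes \<open>p\<close> the midpoint of \<open>t / L\<close> and
    \<open>1 / 2\<close>.\<close>
  obtain p where p: "p < 1 / 2" "normal_tail ((x - d) / \<sigma>) < p * L"
  proof -
    have "\<exists>p<1 / 2. t < p * L" if "t < L / 2" for t
      using that \<open>L > 0\<close> by (intro exI[of _ "(t / L + 1 / 2) / 2"]) (simp add: field_simps)
    from this[OF d(2)] show ?thesis using that by blast
  qed
  have "p > 0"
    using p(2) \<open>L > 0\<close> std_normal.cdf_bounded_prob[of "(x - d) / \<sigma>"]
    by (metis diff_ge_0_iff_ge le_less_trans zero_less_mult_pos2)
  obtain m0 where m0: "\<And>m. m \<ge> m0 \<Longrightarrow> p < prob {\<omega>\<in>space M. S m \<omega> > 0}"
    using order_tendstoD(1)[OF prob_sum_pos_tendsto p(1)] by (auto simp: eventually_sequentially)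
  have "(\<lambda>n. prob {\<omega>\<in>space M. S n \<omega> > (x - d) * sqrt n} + prob {\<omega>\<in>space M. S m0 \<omega> > d * sqrt n})
      \<longlonglongrightarrow> normal_tail ((x - d) / \<sigma>) + 0"
    by (intro tendsto_add prob_sum_tendsto prob_sum_gt_sqrt_tendsto_0 d)
  then have "eventually (\<lambda>n. prob {\<omega>\<in>space M. S n \<omega> > (x - d) * sqrt n}
      + prob {\<omega>\<in>space M. S m0 \<omega> > d * sqrt n} < p * L) sequentially"
    using order_tendstoD(2) p(2) by force
  then show "eventually (\<lambda>n. prob (exceeds n (x * sqrt n)) < L) sequentially"
  proof eventually_elim
    case (elim n)
    have "p * prob (exceeds n (x * sqrt n)) \<le> prob {\<omega>\<in>space M. S (n + m0) \<omega> > x * sqrt n}"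
      by (rule prob_exceeds_upper) (use x m0 less_imp_le in auto)
    \<comment> \<open>Going back from time \<open>n + m0\<close> to time \<open>n\<close> costs the
      slack \<open>d * sqrt n\<close>: the \<open>m0\<close> extra steps exceed it with vanishing
      probability, as \<open>m0\<close> does not depend on \<open>n\<close>.\<close>
    also have "\<dots> \<le> prob ({\<omega>\<in>space M. S n \<omega> > (x - d) * sqrt n} \<union> {\<omega>\<in>space M. (\<Sum>i=n..<n+m0. X i \<omega>) > d * sqrt n})"
    proof (intro finite_measure_mono subsetI)
      fix \<omega> assume *: "\<omega> \<in> {\<omega>\<in>space M. S (n + m0) \<omega> > x * sqrt n}"
      have "S (n + m0) \<omega> = S n \<omega> + (\<Sum>i=n..<n+m0. X i \<omega>)"
        using sum.atLeastLessThan_concat[of 0 n "n+m0" "\<lambda>i. X i \<omega>"] by (simp add: atLeast0LessThan)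
      then show "\<omega> \<in> {\<omega>\<in>space M. S n \<omega> > (x - d) * sqrt n} \<union> {\<omega>\<in>space M. (\<Sum>i=n..<n+m0. X i \<omega>) > d * sqrt n}"
        using * by (auto simp: algebra_simps)
    qed simp
    also have "\<dots> \<le> prob {\<omega>\<in>space M. S n \<omega> > (x - d) * sqrt n} + prob {\<omega>\<in>space M. (\<Sum>i=n..<n+m0. X i \<omega>) > d * sqrt n}"
      by (rule measure_Un_le) simp_all
    also have "prob {\<omega>\<in>space M. (\<Sum>i=n..<n+m0. X i \<omega>) > d * sqrt n} = prob {\<omega>\<in>space M. S m0 \<omega> > d * sqrt n}"
      using prob_sum_shift[of "{d * sqrt n<..}" n m0] by simp
    finally have "p * prob (exceeds n (x * sqrt n)) < p * L" using elim by simp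
    then show ?case using \<open>p > 0\<close> by simp
  qed
next
  fix l assume l: "l < 2 * normal_tail (x / \<sigma>)"
  have "eventually (\<lambda>d. normal_tail ((x + 2 * d) / \<sigma>) > l / 2) (at_right 0)"
    by (rule order_tendstoD(1)[OF isCont_normal_tail_shift]) (use l in simp)
  then have "eventually (\<lambda>d. d > 0 \<and> normal_tail ((x + 2 * d) / \<sigma>) > l / 2) (at_right 0)"
    by (intro eventually_conj) (auto simp: eventually_at_right_less)
  then obtain d where d: "d > 0" "normal_tail ((x + 2 * d) / \<sigma>) > l / 2"
    using eventually_happens'[OF trivial_limit_at_right_real] by force
  \<comment> \<open>Symmetric to the choice of \<open>p\<close>: now \<open>q\<close> has to lie
    strictly above \<open>1 / 2\<close>. If \<open>l\<close> is not positive, \<open>q = 1\<close>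
    already works.\<close>
  obtain q where q: "q > 1 / 2" "q * l < normal_tail ((x + 2 * d) / \<sigma>)"
  proof (cases "l > 0")
    case True
    have "\<exists>q>1 / 2. q * l < t" if "t > l / 2" for t
      using that True by (intro exI[of _ "(t / l + 1 / 2) / 2"]) (simp add: field_simps)
    from this[OF d(2)] show ?thesis using that by blast
  next
    case False
    then show ?thesis using d(2) by (intro that[of 1]) auto
  qed
  obtain m0 where m0: "\<And>m. m \<ge> m0 \<Longrightarrow> prob {\<omega>\<in>space M. S m \<omega> > 0} < q"
    using order_tendstoD(2)[OF prob_sum_pos_tendsto q(1)] by (auto simp: eventually_sequentially)
  have "(\<lambda>n. prob {\<omega>\<in>space M. S n \<omega> > (x + 2 * d) * sqrt n}
        - (n * prob {\<omega>\<in>space M. X 0 \<omega> > d * sqrt n} + prob {\<omega>\<in>space M. S m0 \<omega> > d * sqrt n}))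
      \<longlonglongrightarrow> normal_tail ((x + 2 * d) / \<sigma>) - (0 + 0)"
    by (intro tendsto_add tendsto_diff prob_sum_tendsto prob_sum_gt_sqrt_tendsto_0 prob_jump_tendsto_0 d)
  then have "eventually (\<lambda>n. q * l < prob {\<omega>\<in>space M. S n \<omega> > (x + 2 * d) * sqrt n}
        - (n * prob {\<omega>\<in>space M. X 0 \<omega> > d * sqrt n} + prob {\<omega>\<in>space M. S m0 \<omega> > d * sqrt n})) sequentially"
    using order_tendstoD(1) q(2) by force
  then show "eventually (\<lambda>n. l < prob (exceeds n (x * sqrt n))) sequentially"
    using eventually_gt_at_top[of 0] eventually_ge_at_top[of m0]
  proof eventually_elim
    case (elim n)
    have "prob {\<omega>\<in>space M. S n \<omega> > x * sqrt n + 2 * (d * sqrt n)}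
      \<le> q * prob (exceeds n (x * sqrt n)) + (n * prob {\<omega>\<in>space M. X 0 \<omega> > d * sqrt n} + prob {\<omega>\<in>space M. S m0 \<omega> > d * sqrt n})"
      by (rule prob_exceeds_lower) (use x d elim m0 less_imp_le in auto)
    then have "q * l < q * prob (exceeds n (x * sqrt n))"
      using elim(1) by (simp add: algebra_simps)
    then show ?case using q(1) by simp
  qed
qed

end

section \<open>Overlaps of translates\<close>

context centered_iid
begin

text \<open>The weak law is drawn from the central limit theorem: \<open>e * n\<close> eventually
  exceeds \<open>K * sqrt n\<close> for every \<open>K\<close>, and \<open>K\<close> can be taken so
  large that the normal tail at \<open>K / \<sigma>\<close> is below \<open>a\<close>.\<close>

lemma prob_sum_gt_linear_tendsto_0:
  fixes e :: real
  assumes e: "e > 0"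
  shows "(\<lambda>n. prob {\<omega>\<in>space M. S n \<omega> > e * n}) \<longlonglongrightarrow> 0"
proof (rule order_tendstoI)
  fix a :: real assume a: "a > 0"
  have "((\<lambda>x. normal_tail (x / \<sigma>)) \<longlongrightarrow> 1 - 1) at_top"
    by (intro tendsto_intros filterlim_compose[OF std_normal.cdf_lim_at_top_prob]) (use sigma_pos in real_asymp)
  then have "eventually (\<lambda>x. normal_tail (x / \<sigma>) < a) at_top"
    using a by (auto dest: order_tendstoD(2))
  then obtain K where K: "normal_tail (K / \<sigma>) < a"
    by (auto simp: eventually_at_top_linorder)
  have "eventually (\<lambda>n :: nat. K * sqrt n \<le> e * n) sequentially"
    using e by real_asymp
  moreover have "eventually (\<lambda>n. prob {\<omega>\<in>space M. S n \<omega> > K * sqrt n} < a) sequentially"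
    by (rule order_tendstoD(2)[OF prob_sum_tendsto K])
  ultimately show "eventually (\<lambda>n. prob {\<omega>\<in>space M. S n \<omega> > e * n} < a) sequentially"
  proof eventually_elim
    case (elim n)
    then have "prob {\<omega>\<in>space M. S n \<omega> > e * n} \<le> prob {\<omega>\<in>space M. S n \<omega> > K * sqrt n}"
      by (intro finite_measure_mono) auto
    then show ?case using elim by simp
  qed
qed (auto intro!: always_eventually intro: less_le_trans)

lemma prob_sum_le_linear_tendsto_0:
  fixes e :: real
  assumes e: "e > 0"
  shows "(\<lambda>n. prob {\<omega>\<in>space M. S n \<omega> \<le> - e * n}) \<longlonglongrightarrow> 0"
proof (rule order_tendstoI)
  fix a :: real assume a: "a > 0"
  have "((\<lambda>x. normal_tail (x / \<sigma>)) \<longlongrightarrow> 1 - 0) at_bot"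
    by (intro tendsto_intros filterlim_compose[OF std_normal.cdf_lim_at_bot]) (use sigma_pos in real_asymp)
  then have "eventually (\<lambda>x. normal_tail (x / \<sigma>) > 1 - a) at_bot"
    using a by (intro order_tendstoD(1)) auto
  then obtain K where K: "1 - a < normal_tail (K / \<sigma>)"
    by (auto simp: eventually_at_bot_linorder)
  have "eventually (\<lambda>n :: nat. - e * n \<le> K * sqrt n) sequentially"
    using e by real_asymp
  moreover have "eventually (\<lambda>n. 1 - a < prob {\<omega>\<in>space M. S n \<omega> > K * sqrt n}) sequentially"
    by (rule order_tendstoD(1)[OF prob_sum_tendsto K])
  ultimately show "eventually (\<lambda>n. prob {\<omega>\<in>space M. S n \<omega> \<le> - e * n} < a) sequentially"
  proof eventually_elim
    case (elim n)
    have "prob {\<omega>\<in>space M. S n \<omega> \<le> - e * n} \<le> prob {\<omega>\<in>space M. \<not> S n \<omega> > K * sqrt n}"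
      using elim by (intro finite_measure_mono) auto
    also have "\<dots> = 1 - prob {\<omega>\<in>space M. S n \<omega> > K * sqrt n}"
      by (rule prob_neg) simp
    finally show ?case using elim by simp
  qed
qed (auto intro!: always_eventually intro: less_le_trans)

end

text \<open>A Steinhaus argument. Enclose \<open>K\<close> in an open \<open>U\<close> with
  \<open>U - K\<close> smaller than \<open>K\<close>. A small translate of \<open>K\<close> stays in
  \<open>U\<close>, has the measure of \<open>K\<close>, and therefore does not fit into
  \<open>U - K\<close>.\<close>

lemma compact_shift_overlap:
  fixes K :: "real set"
  assumes K: "compact K" "emeasure lborel K > 0"
  obtains \<delta> where "\<delta> > 0" "\<And>h. \<bar>h\<bar> < \<delta> \<Longrightarrow> emeasure lborel {x \<in> K. x + h \<in> K} > 0"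
proof -
  have [measurable]: "K \<in> sets borel" using K by (simp add: borel_compact)
  have fin: "emeasure lborel K < \<infinity>" by (rule emeasure_compact_finite[OF K(1)])
  then have "enn2real (emeasure lborel K) > 0"
    using K by (simp add: enn2real_positive_iff)
  then obtain U where U: "open U" "K \<subseteq> U" and "emeasure lborel (U - K) < ennreal (enn2real (emeasure lborel K))"
    by (rule outer_regular_lborel[rotated]) auto
  then have lt: "emeasure lborel (U - K) < emeasure lborel K"
    using fin by simp
  have [measurable]: "U \<in> sets borel" using U by simp
  obtain \<delta> where \<delta>: "\<delta> > 0" "(\<Union>x\<in>K. ball x \<delta>) \<subseteq> U"
    by (rule compact_subset_open_imp_ball_epsilon_subset[OF K(1) U])
  have "emeasure lborel {x \<in> K. x + h \<in> K} > 0" if h: "\<bar>h\<bar> < \<delta>" for h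
  proof (rule ccontr)
    assume "\<not> emeasure lborel {x \<in> K. x + h \<in> K} > 0"
    then have 0: "emeasure lborel {x \<in> K. x + h \<in> K} = 0" by simp
    have "emeasure lborel K = emeasure (distr lborel borel ((+) h)) K"
      by (simp add: lborel_distr_plus)
    also have "\<dots> = emeasure lborel ((+) h -` K)"
      by (subst emeasure_distr) auto
    also have "\<dots> \<le> emeasure lborel ((U - K) \<union> {x \<in> K. x + h \<in> K})"
    proof (rule emeasure_mono)
      show "(+) h -` K \<subseteq> (U - K) \<union> {x \<in> K. x + h \<in> K}"
      proof
        fix x assume "x \<in> (+) h -` K"
        then have "h + x \<in> K" "x \<in> ball (h + x) \<delta>" using h by (auto simp: dist_real_def)
        then have "x \<in> U" using \<delta>(2) by blast
        then show "x \<in> (U - K) \<union> {x \<in> K. x + h \<in> K}"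
          using \<open>h + x \<in> K\<close> by (auto simp: add.commute)
      qed
    qed measurable
    also have "\<dots> \<le> emeasure lborel (U - K) + emeasure lborel {x \<in> K. x + h \<in> K}"
      by (rule emeasure_subadditive) measurable
    finally show False using lt 0 by simp
  qed
  with \<delta>(1) show ?thesis by (rule that)
qed

text \<open>Inner regularity after cutting down to a ball: the piece has finite measure, so a closed
  subset that misses less than all of it has positive measure.\<close>

lemma inner_compact_pos:
  fixes G :: "real set"
  assumes [measurable]: "G \<in> sets borel" and G: "emeasure lborel G > 0"
  obtains K where "compact K" "K \<subseteq> G" "emeasure lborel K > 0"
proof -
  have "\<exists>n :: nat. emeasure lborel (G \<inter> cball 0 n) > 0"
  proof (rule ccontr)
    assume "\<not> (\<exists>n :: nat. emeasure lborel (G \<inter> cball 0 n) > 0)"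
    then have "(\<Union>n :: nat. G \<inter> cball 0 n) \<in> null_sets lborel"
      by (intro null_sets_UN) (auto simp: null_sets_def)
    moreover have "(\<Union>n :: nat. G \<inter> cball 0 n) = G"
      using real_arch_simple by auto
    ultimately show False using G by (auto simp: null_sets_def)
  qed
  then obtain n :: nat where n: "emeasure lborel (G \<inter> cball 0 n) > 0" by blast
  let ?E = "G \<inter> cball 0 (real n)"
  have fin: "emeasure lborel ?E < \<infinity>"
    by (rule le_less_trans[OF emeasure_mono emeasure_compact_finite[of "cball 0 (real n)"]]) auto
  then have "enn2real (emeasure lborel ?E) > 0"
    using n by (simp add: enn2real_positive_iff)
  moreover have "?E \<in> sets lebesgue" by simp
  ultimately obtain K where K: "closed K" "K \<subseteq> ?E" and "emeasure lebesgue (?E - K) < ennreal (enn2real (emeasure lborel ?E))"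
    using sets_lebesgue_inner_closed by metis
  then have lt: "emeasure lborel (?E - K) < emeasure lborel ?E"
    using fin by (simp add: borel_closed)
  have "compact K"
    using K bounded_subset[OF bounded_cball] by (auto simp: compact_eq_bounded_closed)
  moreover have "emeasure lborel K > 0"
  proof (rule ccontr)
    assume "\<not> emeasure lborel K > 0"
    then have 0: "emeasure lborel K = 0" by simp
    have "emeasure lborel ?E \<le> emeasure lborel ((?E - K) \<union> K)"
      using K by (intro emeasure_mono) (auto simp: borel_closed)
    also have "\<dots> \<le> emeasure lborel (?E - K) + emeasure lborel K"
      using K by (intro emeasure_subadditive) (auto simp: borel_closed)
    finally show False using lt 0 by simp
  qed
  ultimately show ?thesis using K that by blast
qed

section \<open>The risk process\<close>

lemma AE_lborel_shift:
  assumes [measurable]: "Measurable.pred borel P"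
  shows "(AE x in lborel. P (x + a)) \<longleftrightarrow> (AE x in lborel. P (x :: real))"
proof -
  have "(AE x in lborel. P x) \<longleftrightarrow> (AE x in distr lborel borel ((+) a). P x)"
    by (simp only: lborel_distr_plus)
  also have "\<dots> \<longleftrightarrow> (AE x in lborel. P (a + x))"
    by (subst AE_distr_iff) auto
  finally show ?thesis by (simp add: add.commute)
qed

lemma abs_diff_cube_le:
  fixes x y :: real
  assumes "x \<ge> 0" "y \<ge> 0"
  shows "\<bar>x - y\<bar> ^ 3 \<le> x ^ 3 + y ^ 3"
proof -
  have "\<bar>x - y\<bar> ^ 3 \<le> (max x y) ^ 3"
    using assms by (intro power_mono) auto
  also have "\<dots> \<le> x ^ 3 + y ^ 3"
    using assms by (auto simp: max_def)
  finally show ?thesis .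
qed

text \<open>A variance of zero would concentrate all mass at the mean. This supplies the positive
  standard deviation for the waiting times and for the steps of the walk.\<close>

lemma (in prob_space) variance_pos_of_no_atom:
  fixes Z :: "'a \<Rightarrow> real"
  assumes [measurable]: "Z \<in> borel_measurable M" and int: "integrable M (\<lambda>\<omega>. (Z \<omega>)\<^sup>2)"
    and atom: "prob {\<omega>\<in>space M. Z \<omega> = expectation Z} = 0"
  shows "variance Z > 0"
proof -
  have intZ: "integrable M Z" by (rule square_integrable_imp_integrable) (use int in auto)
  have int': "integrable M (\<lambda>\<omega>. (Z \<omega> - expectation Z)\<^sup>2)"
    using int intZ by (simp add: power2_diff)
  have "variance Z \<noteq> 0"
  proof
    assume "variance Z = 0"
    then have "AE \<omega> in M. (Z \<omega> - expectation Z)\<^sup>2 = 0"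
      using integral_nonneg_eq_0_iff_AE[OF int'] by simp
    then have "AE \<omega> in M. Z \<omega> = expectation Z" by simp
    then have "prob {\<omega>\<in>space M. Z \<omega> = expectation Z} = 1" by (intro prob_Collect_eq_1[THEN iffD2]) auto
    then show False using atom by simp
  qed
  then show ?thesis using variance_positive[of Z] by (simp only: less_le not_False_eq_True) simp
qed

lemma (in prob_space) prob_eq_0_of_density:
  assumes "distributed M lborel Z f"
  shows "prob {\<omega>\<in>space M. Z \<omega> = (a :: real)} = 0"
proof -
  have "emeasure M (Z -` {a} \<inter> space M) = (\<integral>\<^sup>+x. f x * indicator {a} x \<partial>lborel)"
    by (rule distributed_emeasure[OF assms]) simp
  also have "\<dots> = 0"
    using AE_lborel_singleton[of a] assms
    by (subst nn_integral_0_iff_AE) (auto simp: distributed_def elim!: eventually_mono)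
  finally show ?thesis
    by (simp add: measure_def vimage_def Int_def conj_commute)
qed

text \<open>Merges both sequences into one family over \<open>bool \<times> nat\<close>, so that
  coordinates can afterwards be regrouped freely. A finite index set splits into its two sections;
  independence between the sequences separates these, and independence within each sequence finishes
  the factorization.\<close>

lemma (in prob_space) indep_vars_interleave:
  fixes T Y :: "nat \<Rightarrow> 'a \<Rightarrow> 'b"
  assumes T: "indep_vars (\<lambda>_. N) T UNIV" and Y: "indep_vars (\<lambda>_. N) Y UNIV"
    and TY: "indep_var (Pi\<^sub>M UNIV (\<lambda>_. N)) (\<lambda>\<omega> i. T i \<omega>) (Pi\<^sub>M UNIV (\<lambda>_. N)) (\<lambda>\<omega> i. Y i \<omega>)"
  shows "indep_vars (\<lambda>_. N) (\<lambda>(b, i). if b then Y i else T i) UNIV"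
proof -
  let ?Z = "\<lambda>(b, i). if b then Y i else T i"
  have [measurable]: "T i \<in> measurable M N" "Y i \<in> measurable M N" for i
    using T Y by (auto simp: indep_vars_def2)
  have part: "prob (\<Inter>i\<in>I. X i -` A i \<inter> space M \<inter> space M) = (\<Prod>i\<in>I. prob (X i -` A i \<inter> space M))"
    if "indep_vars (\<lambda>_. N) X UNIV" "finite I" "I \<noteq> {}" "\<And>i. i \<in> I \<Longrightarrow> A i \<in> sets N"
    for X :: "nat \<Rightarrow> 'a \<Rightarrow> 'b" and I and A :: "nat \<Rightarrow> 'b set"
    using indep_varsD[OF that(1), of I A] that by simp
  \<comment> \<open>The empty index set must be allowed, because one of the two sections of a
    nonempty \<open>J\<close> may be empty.\<close>
  have part': "prob {\<omega>\<in>space M. \<forall>i\<in>I. X i \<omega> \<in> A i} = (\<Prod>i\<in>I. prob (X i -` A i \<inter> space M))"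
    if "indep_vars (\<lambda>_. N) X UNIV" "finite I" "\<And>i. i \<in> I \<Longrightarrow> A i \<in> sets N"
    for X :: "nat \<Rightarrow> 'a \<Rightarrow> 'b" and I and A :: "nat \<Rightarrow> 'b set"
  proof (cases "I = {}")
    case False
    then have "{\<omega>\<in>space M. \<forall>i\<in>I. X i \<omega> \<in> A i} = (\<Inter>i\<in>I. X i -` A i \<inter> space M \<inter> space M)" by auto
    then show ?thesis using part[of X I A] False that by simp
  qed (simp add: prob_space)
  have rv: "?Z i \<in> measurable M N" for i :: "bool \<times> nat"
    by (cases i) auto
  have "indep_sets (\<lambda>i. {?Z i -` A \<inter> space M |A. A \<in> sets N}) UNIV"
  proof (rule indep_setsI)
    fix i :: "bool \<times> nat" show "{?Z i -` A \<inter> space M |A. A \<in> sets N} \<subseteq> events"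
      using rv[of i] by (auto intro: measurable_sets)
  next
    fix E and J :: "(bool \<times> nat) set"
    assume J: "J \<noteq> {}" "finite J" and E: "\<forall>j\<in>J. E j \<in> {?Z j -` A \<inter> space M |A. A \<in> sets N}"
    from E have "\<forall>j\<in>J. \<exists>A. E j = ?Z j -` A \<inter> space M \<and> A \<in> sets N" by auto
    from bchoice[OF this] obtain A
      where A: "\<And>j. j \<in> J \<Longrightarrow> E j = ?Z j -` A j \<inter> space M" "\<And>j. j \<in> J \<Longrightarrow> A j \<in> sets N"
      by blast
    define I where "I b = {i. (b, i) \<in> J}" for b
    have J_iff: "(\<forall>j\<in>J. P j) \<longleftrightarrow> (\<forall>b. \<forall>i\<in>I b. P (b, i))" for P
      unfolding I_def Ball_def split_paired_All mem_Collect_eq ..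
    have finI: "finite (I b)" for b
      unfolding I_def by (rule finite_subset[OF _ finite_imageI[OF J(2), of snd]]) force
    have Isets: "{f\<in>space (Pi\<^sub>M UNIV (\<lambda>_ :: nat. N)). \<forall>i\<in>I b. f i \<in> A (b, i)} \<in> sets (Pi\<^sub>M UNIV (\<lambda>_. N))" for b
    proof -
      have [measurable]: "A (b, i) \<in> sets N" if "i \<in> I b" for i using that A by (auto simp: I_def)
      show ?thesis using finI[of b] by (intro sets.sets_Collect_finite_All) (auto intro!: measurable_sets_Collect)
    qed
    have sp: "(\<lambda>i. T i \<omega>) \<in> space (Pi\<^sub>M UNIV (\<lambda>_. N))" "(\<lambda>i. Y i \<omega>) \<in> space (Pi\<^sub>M UNIV (\<lambda>_. N))"
      if "\<omega> \<in> space M" for \<omega>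
      using that by (auto simp: space_PiM intro: measurable_space[of _ M])
    have "prob ((\<lambda>\<omega>. (\<lambda>i. T i \<omega>, \<lambda>i. Y i \<omega>)) -`
        ({f\<in>space (Pi\<^sub>M UNIV (\<lambda>_ :: nat. N)). \<forall>i\<in>I False. f i \<in> A (False, i)}
          \<times> {f\<in>space (Pi\<^sub>M UNIV (\<lambda>_ :: nat. N)). \<forall>i\<in>I True. f i \<in> A (True, i)}) \<inter> space M)
      = prob ((\<lambda>\<omega> i. T i \<omega>) -` {f\<in>space (Pi\<^sub>M UNIV (\<lambda>_ :: nat. N)). \<forall>i\<in>I False. f i \<in> A (False, i)} \<inter> space M)
       * prob ((\<lambda>\<omega> i. Y i \<omega>) -` {f\<in>space (Pi\<^sub>M UNIV (\<lambda>_ :: nat. N)). \<forall>i\<in>I True. f i \<in> A (True, i)} \<inter> space M)"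
      by (rule indep_varD[OF TY Isets Isets])
    also have "(\<lambda>\<omega>. (\<lambda>i. T i \<omega>, \<lambda>i. Y i \<omega>)) -`
        ({f\<in>space (Pi\<^sub>M UNIV (\<lambda>_ :: nat. N)). \<forall>i\<in>I False. f i \<in> A (False, i)}
          \<times> {f\<in>space (Pi\<^sub>M UNIV (\<lambda>_ :: nat. N)). \<forall>i\<in>I True. f i \<in> A (True, i)}) \<inter> space M = (\<Inter>j\<in>J. E j)"
    proof -
      have "\<omega> \<in> (\<Inter>j\<in>J. E j) \<longleftrightarrow> \<omega> \<in> space M \<and> (\<forall>i\<in>I False. T i \<omega> \<in> A (False, i)) \<and> (\<forall>i\<in>I True. Y i \<omega> \<in> A (True, i))" for \<omega>
      proof -
        have "\<omega> \<in> (\<Inter>j\<in>J. E j) \<longleftrightarrow> \<omega> \<in> space M \<and> (\<forall>j\<in>J. ?Z j \<omega> \<in> A j)"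
        proof -
          have "\<omega> \<in> E j \<longleftrightarrow> \<omega> \<in> space M \<and> ?Z j \<omega> \<in> A j" if "j \<in> J" for j
            unfolding A(1)[OF that] by blast
          then show ?thesis using J(1) by blast
        qed
        also have "(\<forall>j\<in>J. ?Z j \<omega> \<in> A j) \<longleftrightarrow> (\<forall>b. \<forall>i\<in>I b. ?Z (b, i) \<omega> \<in> A (b, i))"
          by (rule J_iff)
        finally show ?thesis by (simp add: all_bool_eq conj_commute)
      qed
      then show ?thesis using sp by auto
    qed
    also have "(\<lambda>\<omega> i. T i \<omega>) -` {f\<in>space (Pi\<^sub>M UNIV (\<lambda>_ :: nat. N)). \<forall>i\<in>I False. f i \<in> A (False, i)} \<inter> space M
        = {\<omega>\<in>space M. \<forall>i\<in>I False. T i \<omega> \<in> A (False, i)}"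
      using sp by auto
    also have "prob \<dots> = (\<Prod>i\<in>I False. prob (T i -` A (False, i) \<inter> space M))"
      by (rule part'[OF T finI]) (use A in \<open>auto simp: I_def\<close>)
    also have "(\<lambda>\<omega> i. Y i \<omega>) -` {f\<in>space (Pi\<^sub>M UNIV (\<lambda>_ :: nat. N)). \<forall>i\<in>I True. f i \<in> A (True, i)} \<inter> space M
        = {\<omega>\<in>space M. \<forall>i\<in>I True. Y i \<omega> \<in> A (True, i)}"
      using sp by auto
    also have "prob \<dots> = (\<Prod>i\<in>I True. prob (Y i -` A (True, i) \<inter> space M))"
      by (rule part'[OF Y finI]) (use A in \<open>auto simp: I_def\<close>)
    also have "(\<Prod>i\<in>I False. prob (T i -` A (False, i) \<inter> space M)) * (\<Prod>i\<in>I True. prob (Y i -` A (True, i) \<inter> space M))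
        = (\<Prod>b\<in>UNIV. \<Prod>i\<in>I b. prob (?Z (b, i) -` A (b, i) \<inter> space M))"
      by (simp add: UNIV_bool mult.commute)
    also have "\<dots> = (\<Prod>j\<in>Sigma UNIV I. prob (?Z j -` A j \<inter> space M))"
      using finI by (subst prod.Sigma) (auto intro!: prod.cong)
    also have "Sigma UNIV I = J" by (auto simp: I_def)
    also have "(\<Prod>j\<in>J. prob (?Z j -` A j \<inter> space M)) = (\<Prod>j\<in>J. prob (E j))"
      by (rule prod.cong) (use A in auto)
    finally show "prob (\<Inter>j\<in>J. E j) = (\<Prod>j\<in>J. prob (E j))" .
  qed
  then show ?thesis unfolding indep_vars_def2 using rv by blast
qed

lemma (in prob_space) indep_vars_pairs:
  fixes T Y :: "nat \<Rightarrow> 'a \<Rightarrow> 'b"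
  assumes "indep_vars (\<lambda>_. N) T UNIV" "indep_vars (\<lambda>_. N) Y UNIV"
    "indep_var (Pi\<^sub>M UNIV (\<lambda>_. N)) (\<lambda>\<omega> i. T i \<omega>) (Pi\<^sub>M UNIV (\<lambda>_. N)) (\<lambda>\<omega> i. Y i \<omega>)"
  shows "indep_vars (\<lambda>_. N \<Otimes>\<^sub>M N) (\<lambda>i \<omega>. (T i \<omega>, Y i \<omega>)) UNIV"
proof -
  let ?Z = "\<lambda>(b, i). if b then Y i else T i"
  have "indep_vars (\<lambda>j. PiM {(False, j), (True, j)} (\<lambda>_. N))
      (\<lambda>j \<omega>. restrict (\<lambda>i. ?Z i \<omega>) {(False, j), (True, j)}) UNIV"
    by (rule indep_vars_restrict[OF indep_vars_interleave[OF assms]]) (auto simp: disjoint_family_on_def)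
  then have "indep_vars (\<lambda>_. N \<Otimes>\<^sub>M N) (\<lambda>j \<omega>. (\<lambda>f. (f (False, j), f (True, j)))
      (restrict (\<lambda>i. ?Z i \<omega>) {(False, j), (True, j)})) UNIV"
    by (rule indep_vars_compose2) (intro measurable_Pair measurable_component_singleton; simp)
  then show ?thesis by simp
qed

section \<open>The model and its centered walk\<close>

locale claims_process = prob_space +
  fixes T Y :: "nat \<Rightarrow> 'a \<Rightarrow> real" and f_T f_Y :: "real \<Rightarrow> real"
  assumes T_pos: "\<omega> \<in> space M \<Longrightarrow> 0 < T i \<omega>"
    and Y_pos: "\<omega> \<in> space M \<Longrightarrow> 0 < Y i \<omega>"
    and f_T_nonneg: "0 \<le> f_T x"
    and f_Y_nonneg: "0 \<le> f_Y x"
    and T_density: "distributed M lborel (T i) (\<lambda>x. ennreal (f_T x))"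
    and Y_density: "distributed M lborel (Y i) (\<lambda>x. ennreal (f_Y x))"
    and T_indep: "indep_vars (\<lambda>_. borel) T UNIV"
    and Y_indep: "indep_vars (\<lambda>_. borel) Y UNIV"
    and T_Y_indep: "indep_var (Pi\<^sub>M UNIV (\<lambda>_. borel)) (\<lambda>\<omega> i. T i \<omega>) (Pi\<^sub>M UNIV (\<lambda>_. borel)) (\<lambda>\<omega> i. Y i \<omega>)"
    and T_cube: "integrable M (\<lambda>\<omega>. T 0 \<omega> ^ 3)"
    and Y_cube: "integrable M (\<lambda>\<omega>. Y 0 \<omega> ^ 3)"
begin

lemma measurable_T [measurable]: "T i \<in> borel_measurable M"
  and measurable_Y [measurable]: "Y i \<in> borel_measurable M"
  using T_indep Y_indep by (auto simp: indep_vars_def2)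

lemma measurable_f [measurable]: "f_T \<in> borel_measurable borel" "f_Y \<in> borel_measurable borel"
  using distributed_real_measurable[OF f_T_nonneg T_density[of 0]]
    distributed_real_measurable[OF f_Y_nonneg Y_density[of 0]] by simp_all

lemma indep_T_Y: "indep_var borel (T i) borel (Y i)"
proof -
  have "indep_var borel ((\<lambda>f. f i) \<circ> (\<lambda>\<omega> i. T i \<omega>)) borel ((\<lambda>f. f i) \<circ> (\<lambda>\<omega> i. Y i \<omega>))"
    by (rule indep_var_compose[OF T_Y_indep]) auto
  then show ?thesis by (simp add: comp_def)
qed

lemma T_Y_density:
  "distributed M (lborel \<Otimes>\<^sub>M lborel) (\<lambda>\<omega>. (T i \<omega>, Y i \<omega>)) (\<lambda>(\<tau>, y). ennreal (f_T \<tau>) * ennreal (f_Y y))"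
proof (rule distributed_joint_indep)
  \<comment> \<open>Densities are stated over \<open>lborel\<close> and independence over
    \<open>borel\<close>; a distribution sees only the measurable sets of its target, which
    coincide.\<close>
  have "distr M lborel Z = distr M borel Z" for Z :: "'a \<Rightarrow> real"
    by (rule distr_cong) auto
  moreover have "distr M (lborel \<Otimes>\<^sub>M lborel) Z = distr M (borel \<Otimes>\<^sub>M borel) Z" for Z :: "'a \<Rightarrow> real \<times> real"
    by (rule distr_cong) (auto intro: sets_pair_measure_cong)
  ultimately show "indep_var lborel (T i) lborel (Y i)"
    using indep_T_Y[of i] by (simp add: indep_var_distribution_eq)
qed (auto intro: T_density Y_density lborel.sigma_finite_measure_axioms)

text \<open>Equality of the laws is read off from the joint density, in which \<open>i\<close> does
  not occur.\<close>

sublocale pairs: iid_sequence M "\<lambda>i \<omega>. (T i \<omega>, Y i \<omega>)" "borel \<Otimes>\<^sub>M borel"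
proof
  show "indep_vars (\<lambda>_. borel \<Otimes>\<^sub>M borel) (\<lambda>i \<omega>. (T i \<omega>, Y i \<omega>)) UNIV"
    by (rule indep_vars_pairs[OF T_indep Y_indep T_Y_indep])
  have "distr M (borel \<Otimes>\<^sub>M borel) (\<lambda>\<omega>. (T i \<omega>, Y i \<omega>))
      = density (lborel \<Otimes>\<^sub>M lborel) (\<lambda>(\<tau>, y). ennreal (f_T \<tau>) * ennreal (f_Y y))" for i
  proof -
    have "distr M (borel \<Otimes>\<^sub>M borel) (\<lambda>\<omega>. (T i \<omega>, Y i \<omega>)) = distr M (lborel \<Otimes>\<^sub>M lborel) (\<lambda>\<omega>. (T i \<omega>, Y i \<omega>))"
      by (rule distr_cong) (auto intro: sets_pair_measure_cong)
    then show ?thesis using distributed_distr_eq_density[OF T_Y_density[of i]] by simp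
  qed
  then show "distr M (borel \<Otimes>\<^sub>M borel) (\<lambda>\<omega>. (T i \<omega>, Y i \<omega>)) = distr M (borel \<Otimes>\<^sub>M borel) (\<lambda>\<omega>. (T 0 \<omega>, Y 0 \<omega>))" for i
    by metis
qed

text \<open>The rate \<open>c_star\<close>, that is \<open>1 / M\<close>: exactly the rate at which
  the steps \<open>X i\<close> have mean zero.\<close>

definition c :: real where "c = expectation (Y 0) / expectation (T 0)"

definition X :: "nat \<Rightarrow> 'a \<Rightarrow> real" where "X i \<omega> = Y i \<omega> - c * T i \<omega>"

lemma measurable_X [measurable]: "X i \<in> borel_measurable M"
  unfolding X_def by measurable

lemma integrable_T: "integrable M (T 0)" "integrable M (\<lambda>\<omega>. (T 0 \<omega>)\<^sup>2)"
  and integrable_Y: "integrable M (Y 0)" "integrable M (\<lambda>\<omega>. (Y 0 \<omega>)\<^sup>2)"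
proof -
  have le: "x\<^sup>2 \<le> 1 + x ^ 3" if "x > 0" for x :: real
  proof (cases "x \<le> 1")
    case True
    then have "x\<^sup>2 \<le> 1" using that by (intro power_le_one) auto
    moreover have "x ^ 3 \<ge> 0" using that by simp
    ultimately show ?thesis by linarith
  next
    case False
    then have "x\<^sup>2 \<le> x ^ 3" by (intro power_increasing) auto
    then show ?thesis by simp
  qed
  have sq: "integrable M (\<lambda>\<omega>. (Z \<omega>)\<^sup>2)"
    if "Z \<in> borel_measurable M" "\<And>\<omega>. \<omega> \<in> space M \<Longrightarrow> Z \<omega> > 0" "integrable M (\<lambda>\<omega>. Z \<omega> ^ 3)" for Z :: "'a \<Rightarrow> real"
  proof (rule Bochner_Integration.integrable_bound[of M "\<lambda>\<omega>. 1 + Z \<omega> ^ 3"])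
    show "AE \<omega> in M. norm ((Z \<omega>)\<^sup>2) \<le> norm (1 + Z \<omega> ^ 3)"
    proof (rule AE_I2)
      fix \<omega> assume "\<omega> \<in> space M"
      then show "norm ((Z \<omega>)\<^sup>2) \<le> norm (1 + Z \<omega> ^ 3)" using le[OF that(2)[of \<omega>]] by simp
    qed
  qed (use that in auto)
  show T2: "integrable M (\<lambda>\<omega>. (T 0 \<omega>)\<^sup>2)" by (rule sq[OF _ T_pos T_cube]) auto
  show Y2: "integrable M (\<lambda>\<omega>. (Y 0 \<omega>)\<^sup>2)" by (rule sq[OF _ Y_pos Y_cube]) auto
  show "integrable M (T 0)" by (rule square_integrable_imp_integrable) (use T2 in auto)
  show "integrable M (Y 0)" by (rule square_integrable_imp_integrable) (use Y2 in auto)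
qed

lemma expectation_pos: "expectation (T 0) > 0" "expectation (Y 0) > 0"
proof -
  have pos: "expectation Z > 0" if "integrable M Z" "\<And>\<omega>. \<omega> \<in> space M \<Longrightarrow> Z \<omega> > 0" for Z :: "'a \<Rightarrow> real"
  proof -
    have "expectation Z \<noteq> 0"
    proof
      assume "expectation Z = 0"
      then have "AE \<omega> in M. Z \<omega> = 0"
        using integral_nonneg_eq_0_iff_AE[OF that(1)] that(2) by (auto intro: less_imp_le)
      moreover have "AE \<omega> in M. Z \<omega> \<noteq> 0" using that(2) by (force intro: AE_I2)
      ultimately have "AE \<omega> in M. False" by eventually_elim simp
      then show False by simp
    qed
    moreover have "expectation Z \<ge> 0" using that(2) by (intro integral_nonneg_AE AE_I2) (auto intro: less_imp_le)
    ultimately show ?thesis by simp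
  qed
  show "expectation (T 0) > 0" by (rule pos[OF integrable_T(1) T_pos])
  show "expectation (Y 0) > 0" by (rule pos[OF integrable_Y(1) Y_pos])
qed

lemma c_pos: "c > 0"
  using expectation_pos by (simp add: c_def)

text \<open>The standard deviation of \<open>X 0\<close>, written through the two variances by
  independence of \<open>T 0\<close> and \<open>Y 0\<close>.\<close>

definition \<sigma> :: real where "\<sigma> = sqrt (variance (Y 0) + c\<^sup>2 * variance (T 0))"

text \<open>Instantiated to obtain the weak law for the renewal epochs.\<close>

sublocale T_centered: centered_iid M "\<lambda>i \<omega>. T i \<omega> - expectation (T 0)" "sqrt (variance (T 0))"
proof -
  have "iid_sequence M (\<lambda>i \<omega>. (\<lambda>w. fst w - expectation (T 0)) (T i \<omega>, Y i \<omega>)) borel"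
    by (rule pairs.iid_sequence_compose) measurable
  then interpret iid_sequence M "\<lambda>i \<omega>. T i \<omega> - expectation (T 0)" borel by simp
  have var: "variance (T 0) > 0"
    by (rule variance_pos_of_no_atom[OF measurable_T integrable_T(2) prob_eq_0_of_density[OF T_density]])
  show "centered_iid M (\<lambda>i \<omega>. T i \<omega> - expectation (T 0)) (sqrt (variance (T 0)))"
  proof
    show "expectation (\<lambda>\<omega>. T 0 \<omega> - expectation (T 0)) = 0"
      using integrable_T by (simp add: prob_space)
    show "integrable M (\<lambda>\<omega>. (T 0 \<omega> - expectation (T 0))\<^sup>2)"
      using integrable_T by (simp add: power2_diff)
    show "integrable M (\<lambda>\<omega>. \<bar>T 0 \<omega> - expectation (T 0)\<bar> ^ 3)"
    proof (rule Bochner_Integration.integrable_bound[of M "\<lambda>\<omega>. T 0 \<omega> ^ 3 + expectation (T 0) ^ 3"])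
      show "AE \<omega> in M. norm (\<bar>T 0 \<omega> - expectation (T 0)\<bar> ^ 3) \<le> norm (T 0 \<omega> ^ 3 + expectation (T 0) ^ 3)"
      proof (rule AE_I2)
        fix \<omega> assume "\<omega> \<in> space M"
        then have "\<bar>T 0 \<omega> - expectation (T 0)\<bar> ^ 3 \<le> T 0 \<omega> ^ 3 + expectation (T 0) ^ 3"
          using T_pos expectation_pos by (intro abs_diff_cube_le) (auto intro: less_imp_le)
        then show "norm (\<bar>T 0 \<omega> - expectation (T 0)\<bar> ^ 3) \<le> norm (T 0 \<omega> ^ 3 + expectation (T 0) ^ 3)" by simp
      qed
    qed (use T_cube in auto)
  qed (use var in auto)
qed

lemma indep_expectation_mult:
  "expectation (\<lambda>\<omega>. (T 0 \<omega> - expectation (T 0)) * (Y 0 \<omega> - expectation (Y 0))) = 0"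
  "integrable M (\<lambda>\<omega>. (T 0 \<omega> - expectation (T 0)) * (Y 0 \<omega> - expectation (Y 0)))"
proof -
  have ind: "indep_var borel (\<lambda>\<omega>. T 0 \<omega> - expectation (T 0)) borel (\<lambda>\<omega>. Y 0 \<omega> - expectation (Y 0))"
    using indep_var_compose[OF indep_T_Y[of 0], of "\<lambda>x. x - expectation (T 0)" borel "\<lambda>x. x - expectation (Y 0)" borel]
    by (simp add: comp_def)
  have int: "integrable M (\<lambda>\<omega>. T 0 \<omega> - expectation (T 0))" "integrable M (\<lambda>\<omega>. Y 0 \<omega> - expectation (Y 0))"
    using integrable_T integrable_Y by auto
  show "integrable M (\<lambda>\<omega>. (T 0 \<omega> - expectation (T 0)) * (Y 0 \<omega> - expectation (Y 0)))"
    by (rule indep_var_integrable[OF ind int])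
  show "expectation (\<lambda>\<omega>. (T 0 \<omega> - expectation (T 0)) * (Y 0 \<omega> - expectation (Y 0))) = 0"
    using indep_var_lebesgue_integral[OF ind int] integrable_T by (simp add: prob_space)
qed

text \<open>The pair \<open>(T i, X i)\<close> has the density \<open>f_T \<tau> * f_Y (z + c * \<tau>)\<close> at \<open>(\<tau>, z)\<close>.\<close>

lemma prob_T_X_eq_0_iff:
  assumes C [measurable]: "Measurable.pred (borel \<Otimes>\<^sub>M borel) (\<lambda>(\<tau>, z). C \<tau> z)"
  shows "prob {\<omega>\<in>space M. C (T i \<omega>) (X i \<omega>)} = 0 \<longleftrightarrow>
    (AE z in lborel. AE \<tau> in lborel. \<not> (C \<tau> z \<and> f_T \<tau> > 0 \<and> f_Y (z + c * \<tau>) > 0))"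
proof -
  have C' [measurable]: "Measurable.pred (borel \<Otimes>\<^sub>M borel) (\<lambda>w. C (fst w) (snd w))"
    using C by (simp add: case_prod_beta')
  have C2 [measurable]: "Measurable.pred (borel \<Otimes>\<^sub>M borel) (\<lambda>w. C (fst w) (snd w - c * fst w))"
    by (rule measurable_compose[OF _ C', of "\<lambda>w. (fst w, snd w - c * fst w)", simplified]) measurable
  have C3: "Measurable.pred borel (\<lambda>y. C \<tau> (y - c * \<tau>))" for \<tau>
    by (rule measurable_compose[OF _ C', of "\<lambda>y. (\<tau>, y - c * \<tau>)", simplified]) measurable
  have shift: "(AE y in lborel. \<not> (C \<tau> (y - c * \<tau>) \<and> f_T \<tau> > 0 \<and> f_Y y > 0)) \<longleftrightarrow>
      (AE z in lborel. \<not> (C \<tau> z \<and> f_T \<tau> > 0 \<and> f_Y (z + c * \<tau>) > 0))" for \<tau>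
  proof -
    note C3[measurable]
    show ?thesis
      using AE_lborel_shift[of "\<lambda>y. \<not> (C \<tau> (y - c * \<tau>) \<and> f_T \<tau> > 0 \<and> f_Y y > 0)" "c * \<tau>"] by simp
  qed
  let ?A = "{w \<in> space (lborel \<Otimes>\<^sub>M lborel). C (fst w) (snd w - c * fst w)}"
  have A: "?A \<in> sets (lborel \<Otimes>\<^sub>M lborel)" by measurable
  have "prob {\<omega>\<in>space M. C (T i \<omega>) (X i \<omega>)} = 0 \<longleftrightarrow> emeasure M ((\<lambda>\<omega>. (T i \<omega>, Y i \<omega>)) -` ?A \<inter> space M) = 0"
    by (simp add: emeasure_eq_measure X_def vimage_def Int_def conj_commute space_pair_measure)
  also have "\<dots> \<longleftrightarrow> (\<integral>\<^sup>+w. (case w of (\<tau>, y) \<Rightarrow> ennreal (f_T \<tau>) * ennreal (f_Y y)) * indicator ?A w \<partial>(lborel \<Otimes>\<^sub>M lborel)) = 0"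
    by (subst distributed_emeasure[OF T_Y_density A]) simp
  also have "\<dots> \<longleftrightarrow> (AE w in lborel \<Otimes>\<^sub>M lborel. \<not> (C (fst w) (snd w - c * fst w) \<and> f_T (fst w) > 0 \<and> f_Y (snd w) > 0))"
    using f_T_nonneg f_Y_nonneg
    by (subst nn_integral_0_iff_AE)
       (auto simp: case_prod_beta' indicator_def ennreal_eq_0_iff not_less space_pair_measure intro!: AE_cong)
  also have "\<dots> \<longleftrightarrow> (AE \<tau> in lborel. AE y in lborel. \<not> (C \<tau> (y - c * \<tau>) \<and> f_T \<tau> > 0 \<and> f_Y y > 0))"
    by (rule lborel_pair.AE_pair_iff[of "\<lambda>\<tau> y. \<not> (C \<tau> (y - c * \<tau>) \<and> f_T \<tau> > 0 \<and> f_Y y > 0)", symmetric])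
       measurable
  also have "\<dots> \<longleftrightarrow> (AE \<tau> in lborel. AE z in lborel. \<not> (C \<tau> z \<and> f_T \<tau> > 0 \<and> f_Y (z + c * \<tau>) > 0))"
    by (simp only: shift)
  \<comment> \<open>The exchange puts \<open>z\<close> outside: for a fixed step size
    \<open>z\<close> the condition describes a set of waiting times, and translates of such sets are
    compared later.\<close>
  also have "\<dots> \<longleftrightarrow> (AE z in lborel. AE \<tau> in lborel. \<not> (C \<tau> z \<and> f_T \<tau> > 0 \<and> f_Y (z + c * \<tau>) > 0))"
    by (rule lborel_pair.AE_commute[of "\<lambda>\<tau> z. \<not> (C \<tau> z \<and> f_T \<tau> > 0 \<and> f_Y (z + c * \<tau>) > 0)"]) measurable
  finally show ?thesis .
qed

lemma prob_X_eq: "prob {\<omega>\<in>space M. X i \<omega> = v} = 0"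
  using prob_T_X_eq_0_iff[of "\<lambda>\<tau> z. z = v" i] AE_lborel_singleton[of v]
  by (auto elim!: eventually_mono)

lemma X_square:
  "(X i \<omega>)\<^sup>2 = (Y i \<omega> - expectation (Y 0))\<^sup>2 + c\<^sup>2 * (T i \<omega> - expectation (T 0))\<^sup>2
      - 2 * c * ((T i \<omega> - expectation (T 0)) * (Y i \<omega> - expectation (Y 0)))"
proof -
  \<comment> \<open>At this \<open>c\<close> the means cancel, so both variables may be centered for
    free.\<close>
  have X: "X i \<omega> = (Y i \<omega> - expectation (Y 0)) - c * (T i \<omega> - expectation (T 0))"
    using expectation_pos by (simp add: X_def c_def field_simps)
  show ?thesis unfolding X by (simp add: power2_eq_square algebra_simps)
qed

lemma integrable_X: "integrable M (X 0)" "expectation (X 0) = 0" "integrable M (\<lambda>\<omega>. (X 0 \<omega>)\<^sup>2)"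
proof -
  show "integrable M (X 0)" unfolding X_def using integrable_T integrable_Y by simp
  show 0: "expectation (X 0) = 0"
    unfolding X_def using integrable_T integrable_Y expectation_pos by (simp add: c_def)
  show "integrable M (\<lambda>\<omega>. (X 0 \<omega>)\<^sup>2)"
    unfolding X_square
    by (intro Bochner_Integration.integrable_add Bochner_Integration.integrable_diff integrable_mult_right indep_expectation_mult)
       (use integrable_T integrable_Y in \<open>auto simp: power2_diff\<close>)
qed

lemma expectation_X_square: "expectation (\<lambda>\<omega>. (X 0 \<omega>)\<^sup>2) = variance (Y 0) + c\<^sup>2 * variance (T 0)"
proof -
  have i1: "integrable M (\<lambda>\<omega>. (Y 0 \<omega> - expectation (Y 0))\<^sup>2)"
    and i2: "integrable M (\<lambda>\<omega>. c\<^sup>2 * (T 0 \<omega> - expectation (T 0))\<^sup>2)"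
    using integrable_T integrable_Y by (auto simp: power2_diff)
  show ?thesis
    unfolding X_square using i1 i2 indep_expectation_mult
    by (subst Bochner_Integration.integral_diff) (auto simp: Bochner_Integration.integral_add)
qed

sublocale centered_iid M X \<sigma>
proof -
  have "iid_sequence M (\<lambda>i \<omega>. (\<lambda>w. snd w - c * fst w) (T i \<omega>, Y i \<omega>)) borel"
    by (rule pairs.iid_sequence_compose) measurable
  then interpret iid_sequence M X borel by (simp add: X_def[abs_def])
  have var: "variance (X 0) > 0"
    by (rule variance_pos_of_no_atom[OF measurable_X integrable_X(3) prob_X_eq])
  show "centered_iid M X \<sigma>"
  proof
    show "\<sigma> > 0" using var expectation_X_square integrable_X(2) by (simp add: \<sigma>_def)
    then show "expectation (\<lambda>\<omega>. (X 0 \<omega>)\<^sup>2) = \<sigma>\<^sup>2"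
      by (simp add: expectation_X_square \<sigma>_def)
    show "integrable M (\<lambda>\<omega>. \<bar>X 0 \<omega>\<bar> ^ 3)"
    proof (rule Bochner_Integration.integrable_bound[of M "\<lambda>\<omega>. Y 0 \<omega> ^ 3 + (c * T 0 \<omega>) ^ 3"])
      show "AE \<omega> in M. norm (\<bar>X 0 \<omega>\<bar> ^ 3) \<le> norm (Y 0 \<omega> ^ 3 + (c * T 0 \<omega>) ^ 3)"
      proof (rule AE_I2)
        fix \<omega> assume "\<omega> \<in> space M"
        then have "\<bar>X 0 \<omega>\<bar> ^ 3 \<le> Y 0 \<omega> ^ 3 + (c * T 0 \<omega>) ^ 3"
          unfolding X_def using T_pos Y_pos c_pos by (intro abs_diff_cube_le) (auto intro: less_imp_le)
        then show "norm (\<bar>X 0 \<omega>\<bar> ^ 3) \<le> norm (Y 0 \<omega> ^ 3 + (c * T 0 \<omega>) ^ 3)" by simp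
      qed
    qed (use T_cube Y_cube in \<open>auto simp: power_mult_distrib\<close>)
  qed (use integrable_X in auto)
qed

end

section \<open>Distribution of the running maximum at time t\<close>

text \<open>By Fubini: for each value of \<open>W\<close> the event asks \<open>Z\<close> to take a
  single value.\<close>

lemma (in prob_space) prob_add_eq_0:
  fixes Z W :: "'a \<Rightarrow> real"
  assumes ind: "indep_var borel Z borel W" and Z: "\<And>v. prob {\<omega>\<in>space M. Z \<omega> = v} = 0"
  shows "prob {\<omega>\<in>space M. Z \<omega> + W \<omega> = v} = 0"
proof -
  have [measurable]: "Z \<in> borel_measurable M" "W \<in> borel_measurable M"
    using indep_var_rv1[OF ind] indep_var_rv2[OF ind] by auto
  interpret Z: prob_space "distr M borel Z" by (rule prob_space_distr) simp
  interpret W: prob_space "distr M borel W" by (rule prob_space_distr) simp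
  interpret pair_sigma_finite "distr M borel Z" "distr M borel W" ..
  let ?A = "{w :: real \<times> real. fst w + snd w = v}"
  have A [measurable]: "?A \<in> sets (borel \<Otimes>\<^sub>M borel)"
    using measurable_sets_Collect[of "\<lambda>w :: real \<times> real. fst w + snd w" "borel \<Otimes>\<^sub>M borel" borel "\<lambda>x. x = v"]
    by (simp add: space_pair_measure)
  have "emeasure (distr M borel Z \<Otimes>\<^sub>M distr M borel W) ?A = 0"
  proof -
    have "emeasure (distr M borel Z \<Otimes>\<^sub>M distr M borel W) ?A
        = (\<integral>\<^sup>+y. emeasure (distr M borel Z) ((\<lambda>x. (x, y)) -` ?A) \<partial>distr M borel W)"
      by (rule emeasure_pair_measure_alt2) simp
    also have "\<dots> = (\<integral>\<^sup>+y. 0 \<partial>distr M borel W)"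
    proof (rule nn_integral_cong)
      fix y
      have "(\<lambda>x. (x, y)) -` ?A = {v - y}" by auto
      moreover have "emeasure (distr M borel Z) {v - y} = emeasure M {\<omega>\<in>space M. Z \<omega> = v - y}"
        by (subst emeasure_distr) (auto intro!: arg_cong[where f="emeasure M"])
      ultimately show "emeasure (distr M borel Z) ((\<lambda>x. (x, y)) -` ?A) = 0"
        using Z[of "v - y"] by (simp add: emeasure_eq_measure)
    qed
    finally show ?thesis by simp
  qed
  then have "emeasure (distr M (borel \<Otimes>\<^sub>M borel) (\<lambda>\<omega>. (Z \<omega>, W \<omega>))) ?A = 0"
    using ind by (simp add: indep_var_distribution_eq)
  then have "emeasure M ((\<lambda>\<omega>. (Z \<omega>, W \<omega>)) -` ?A \<inter> space M) = 0"
    by (subst (asm) emeasure_distr) auto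
  then show ?thesis
    by (simp add: emeasure_eq_measure vimage_def Int_def conj_commute)
qed

section \<open>Crossing probabilities of the walk and their continuity in the level\<close>

context claims_process
begin

abbreviation \<mu> :: real where "\<mu> \<equiv> expectation (T 0)"

abbreviation \<tau> :: "nat \<Rightarrow> 'a \<Rightarrow> real" where
  "\<tau> n \<omega> \<equiv> \<Sum>i<n. T i \<omega>"

text \<open>The crossing event in terms of walk and renewal epochs alone;
  \<open>prob_crossing_time_le\<close> ties its probability to the crossing time.\<close>

definition crossing :: "real \<Rightarrow> real \<Rightarrow> 'a set" where
  "crossing t u = {\<omega>\<in>space M. \<exists>n\<ge>1. \<tau> n \<omega> \<le> t \<and> S n \<omega> > u}"

lemma sets_crossing [measurable]: "crossing t u \<in> sets M"
  unfolding crossing_def by measurable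

lemma tau_mono:
  assumes "\<omega> \<in> space M" "m \<le> n"
  shows "\<tau> m \<omega> \<le> \<tau> n \<omega>"
  using assms T_pos by (intro sum_mono2) (auto intro: less_imp_le)

lemma prob_crossing_antimono:
  assumes "u \<le> u'"
  shows "prob (crossing t u') \<le> prob (crossing t u)"
  using assms by (intro finite_measure_mono) (force simp: crossing_def)+

lemma prob_tau_le_tendsto_0:
  assumes e: "0 < e"
  shows "(\<lambda>n. prob {\<omega>\<in>space M. \<tau> n \<omega> \<le> (\<mu> - e) * n}) \<longlonglongrightarrow> 0"
  using T_centered.prob_sum_le_linear_tendsto_0[OF e] by (simp add: sum_subtractf algebra_simps)

lemma prob_tau_gt_tendsto_0:
  assumes e: "0 < e"
  shows "(\<lambda>n. prob {\<omega>\<in>space M. \<tau> n \<omega> > (\<mu> + e) * n}) \<longlonglongrightarrow> 0"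
  using T_centered.prob_sum_gt_linear_tendsto_0[OF e] by (simp add: sum_subtractf algebra_simps)

text \<open>For fixed \<open>t\<close> many renewals by time \<open>t\<close> are unlikely. This
  cuts the unbounded number of indices in \<open>crossing\<close> down to finitely many.\<close>

lemma prob_tau_le_const_tendsto_0: "(\<lambda>n. prob {\<omega>\<in>space M. \<tau> n \<omega> \<le> t}) \<longlonglongrightarrow> 0"
proof (rule tendsto_sandwich[OF _ _ tendsto_const prob_tau_le_tendsto_0[of "\<mu> / 2"]])
  have "eventually (\<lambda>n. real n \<ge> t / (\<mu> / 2)) sequentially"
    using eventually_ge_at_top[of "nat \<lceil>t / (\<mu> / 2)\<rceil>"] by eventually_elim linarith
  then show "eventually (\<lambda>n. prob {\<omega>\<in>space M. \<tau> n \<omega> \<le> t} \<le> prob {\<omega>\<in>space M. \<tau> n \<omega> \<le> (\<mu> - \<mu> / 2) * n}) sequentially"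
  proof eventually_elim
    case (elim n)
    then have "t \<le> (\<mu> - \<mu> / 2) * n" using expectation_pos by (simp add: field_simps)
    then show ?case by (intro finite_measure_mono) auto
  qed
qed (use expectation_pos in auto)

text \<open>The last step is independent of the earlier ones and has no atoms. The index is a
  successor because \<open>S 0\<close> is constant.\<close>

lemma prob_S_eq: "prob {\<omega>\<in>space M. S (Suc n) \<omega> = v} = 0"
proof -
  have "indep_var borel (X n) borel (\<lambda>\<omega>. \<Sum>i<n. X i \<omega>)"
    by (rule indep_vars_sum) (auto intro: indep_vars_subset[OF indep])
  from prob_add_eq_0[OF this prob_X_eq] show ?thesis by (simp add: add.commute)
qed

text \<open>The crossing events for \<open>v \<le> w\<close> differ only if some \<open>S n\<close>
  with \<open>n \<le> m\<close> lies between \<open>v\<close> and \<open>w\<close>, or if the first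
  \<open>m\<close> renewals happen by time \<open>t\<close>. The former has at most the increment of
  a finite sum of continuous distribution functions as its probability, the latter is small for
  large \<open>m\<close>.\<close>

lemma isCont_prob_crossing: "isCont (\<lambda>u. prob (crossing t u)) u"
  unfolding continuous_at_eps_delta
proof (intro allI impI)
  fix e :: real assume "e > 0"
  then have "eventually (\<lambda>n. prob {\<omega>\<in>space M. \<tau> n \<omega> \<le> t} < e / 2) sequentially"
    by (intro order_tendstoD(2)[OF prob_tau_le_const_tendsto_0]) auto
  then obtain m where m: "prob {\<omega>\<in>space M. \<tau> m \<omega> \<le> t} < e / 2"
    by (auto simp: eventually_sequentially)
  define F where "F n v = prob {\<omega>\<in>space M. S n \<omega> \<le> v}" for n v
  have F_cont: "isCont (F n) v" if n: "n \<in> {1..m}" for n v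
  proof -
    obtain k where k: "n = Suc k" using n by (cases n) auto
    interpret D: prob_space "distr M borel (S n)" by (rule prob_space_distr) simp
    interpret D: real_distribution "distr M borel (S n)" by unfold_locales simp
    have "F n = cdf (distr M borel (S n))"
      by (rule ext, unfold F_def cdf_def, subst measure_distr) (auto intro!: arg_cong[where f=prob])
    moreover have "measure (distr M borel (S n)) {v} = prob {\<omega>\<in>space M. S n \<omega> = v}"
      by (subst measure_distr) (auto intro!: arg_cong[where f=prob])
    ultimately show ?thesis
      using D.isCont_cdf[of v] prob_S_eq[of k v] k by simp
  qed
  define H where "H v = (\<Sum>n\<in>{1..m}. F n v)" for v
  have "isCont H u"
    unfolding H_def[abs_def] by (intro continuous_intros F_cont)
  then obtain d where d: "d > 0" "\<And>v. dist v u < d \<Longrightarrow> dist (H v) (H u) < e / 2"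
    using \<open>e > 0\<close> unfolding continuous_at_eps_delta by (meson half_gt_zero)
  have diff: "prob (crossing t v) - prob (crossing t w) \<le> H w - H v + prob {\<omega>\<in>space M. \<tau> m \<omega> \<le> t}"
    if "v \<le> w" for v w
  proof -
    let ?B = "\<lambda>n. {\<omega>\<in>space M. v < S n \<omega> \<and> S n \<omega> \<le> w}"
    have "prob (?B n) = F n w - F n v" for n
    proof -
      have "F n w = prob ({\<omega>\<in>space M. S n \<omega> \<le> v} \<union> ?B n)"
        unfolding F_def using that by (intro arg_cong[where f=prob]) auto
      also have "\<dots> = F n v + prob (?B n)"
        unfolding F_def by (rule finite_measure_Union) auto
      finally show ?thesis by simp
    qed
    then have sum: "(\<Sum>n\<in>{1..m}. prob (?B n)) = H w - H v"
      by (simp add: H_def sum_subtractf)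
    have "crossing t v \<subseteq> crossing t w \<union> ((\<Union>n\<in>{1..m}. ?B n) \<union> {\<omega>\<in>space M. \<tau> m \<omega> \<le> t})"
    proof
      fix \<omega> assume "\<omega> \<in> crossing t v"
      then obtain n where n: "\<omega> \<in> space M" "n \<ge> 1" "\<tau> n \<omega> \<le> t" "S n \<omega> > v"
        by (auto simp: crossing_def)
      show "\<omega> \<in> crossing t w \<union> ((\<Union>n\<in>{1..m}. ?B n) \<union> {\<omega>\<in>space M. \<tau> m \<omega> \<le> t})"
      proof (cases "S n \<omega> > w")
        case True
        then have "\<omega> \<in> crossing t w" using n unfolding crossing_def by blast
        then show ?thesis by blast
      next
        case False
        show ?thesis
        proof (cases "n \<le> m")
          case True
          then show ?thesis using n False by auto
        next
          case gt: False
          then have "\<tau> m \<omega> \<le> t" using tau_mono[of \<omega> m n] n by simp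
          then show ?thesis using n by auto
        qed
      qed
    qed
    then have "prob (crossing t v) \<le> prob (crossing t w \<union> ((\<Union>n\<in>{1..m}. ?B n) \<union> {\<omega>\<in>space M. \<tau> m \<omega> \<le> t}))"
      by (rule finite_measure_mono) measurable
    also have "\<dots> \<le> prob (crossing t w) + prob ((\<Union>n\<in>{1..m}. ?B n) \<union> {\<omega>\<in>space M. \<tau> m \<omega> \<le> t})"
      by (rule measure_Un_le) measurable
    also have "prob ((\<Union>n\<in>{1..m}. ?B n) \<union> {\<omega>\<in>space M. \<tau> m \<omega> \<le> t}) \<le> prob (\<Union>n\<in>{1..m}. ?B n) + prob {\<omega>\<in>space M. \<tau> m \<omega> \<le> t}"
      by (rule measure_Un_le) measurable
    also have "prob (\<Union>n\<in>{1..m}. ?B n) \<le> (\<Sum>n\<in>{1..m}. prob (?B n))"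
      by (rule measure_UNION_le) measurable
    finally show ?thesis using sum by simp
  qed
  show "\<exists>d>0. \<forall>v. dist v u < d \<longrightarrow> dist (prob (crossing t v)) (prob (crossing t u)) < e"
  proof (intro exI[of _ d] conjI allI impI d(1))
    fix v assume v: "dist v u < d"
    show "dist (prob (crossing t v)) (prob (crossing t u)) < e"
    proof (cases "v \<le> u")
      case True
      then show ?thesis
        using diff[OF True] prob_crossing_antimono[OF True, of t] d(2)[OF v] m
        unfolding dist_real_def by linarith
    next
      case False
      then have "u \<le> v" by simp
      then show ?thesis
        using diff[OF \<open>u \<le> v\<close>] prob_crossing_antimono[OF \<open>u \<le> v\<close>, of t] d(2)[OF v] m
        unfolding dist_real_def by linarith
    qed
  qed
qed

text \<open>A variable of mean zero without an atom at 0 must take both signs.\<close>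

lemma prob_X_pos: "prob {\<omega>\<in>space M. X i \<omega> > 0} > 0"
  and prob_X_nonpos: "prob {\<omega>\<in>space M. X i \<omega> \<le> 0} > 0"
proof -
  have no0: False if "AE \<omega> in M. X 0 \<omega> = 0"
  proof -
    have "prob {\<omega>\<in>space M. X 0 \<omega> = 0} = 1"
      by (rule prob_Collect_eq_1[THEN iffD2]) (use that in auto)
    then show False using prob_X_eq[of 0 0] by simp
  qed
  have pos: "prob {\<omega>\<in>space M. X 0 \<omega> > 0} \<noteq> 0"
  proof
    assume "prob {\<omega>\<in>space M. X 0 \<omega> > 0} = 0"
    then have "AE \<omega> in M. \<not> X 0 \<omega> > 0"
      by (subst prob_Collect_eq_0[symmetric]) auto
    then have ae: "AE \<omega> in M. 0 \<le> - X 0 \<omega>" by (auto simp: not_less)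
    have "AE \<omega> in M. - X 0 \<omega> = 0"
      using integral_nonneg_eq_0_iff_AE[OF Bochner_Integration.integrable_minus[OF integrable_X(1)] ae] integrable_X(2) by simp
    then show False using no0 by simp
  qed
  have nonpos: "prob {\<omega>\<in>space M. X 0 \<omega> \<le> 0} \<noteq> 0"
  proof
    assume "prob {\<omega>\<in>space M. X 0 \<omega> \<le> 0} = 0"
    then have "AE \<omega> in M. \<not> X 0 \<omega> \<le> 0"
      by (subst prob_Collect_eq_0[symmetric]) auto
    then have ae: "AE \<omega> in M. 0 \<le> X 0 \<omega>" by (auto simp: not_le)
    have "AE \<omega> in M. X 0 \<omega> = 0"
      using integral_nonneg_eq_0_iff_AE[OF integrable_X(1) ae] integrable_X(2) by simp
    then show False using no0 by simp
  qed
  show "prob {\<omega>\<in>space M. X i \<omega> > 0} > 0"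
    using pos prob_eq[of "{0<..}" i] by (simp add: zero_less_measure_iff)
  show "prob {\<omega>\<in>space M. X i \<omega> \<le> 0} > 0"
    using nonpos prob_eq[of "{..0}" i] by (simp add: zero_less_measure_iff)
qed

text \<open>A compact set of positive measure overlaps its small translates in positive measure, so the
  values of \<open>X i\<close> charge every subinterval of some interval.\<close>

lemma jump_interval:
  obtains x0 \<delta> B where "x0 > 0" "\<delta> > 0"
    "\<forall>i x \<eta>. \<bar>x - x0\<bar> < \<delta> \<longrightarrow> \<eta> > 0 \<longrightarrow> prob {\<omega>\<in>space M. \<bar>X i \<omega> - x\<bar> < \<eta> \<and> T i \<omega> \<le> B} > 0"
proof -
  \<comment> \<open>\<open>G z\<close> collects the waiting times \<open>s\<close> at which the
    joint density of \<open>(T i, X i)\<close> is positive at \<open>(s, z)\<close>.\<close>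
  define G where "G z = {s. f_T s > 0 \<and> f_Y (z + c * s) > 0}" for z
  have G [measurable]: "G z \<in> sets borel" for z
    unfolding G_def by measurable
  have "\<exists>z>0. emeasure lborel (G z) > 0"
  proof (rule ccontr)
    assume "\<not> (\<exists>z>0. emeasure lborel (G z) > 0)"
    then have ae: "AE s in lborel. \<not> (f_T s > 0 \<and> f_Y (z + c * s) > 0)" if "z > 0" for z
      using that by (subst AE_iff_measurable[OF _ refl]) (auto simp: G_def)
    have "AE z in lborel. AE s in lborel. \<not> (z > 0 \<and> f_T s > 0 \<and> f_Y (z + c * s) > 0)"
    proof (rule AE_I2)
      fix z
      show "AE s in lborel. \<not> (z > 0 \<and> f_T s > 0 \<and> f_Y (z + c * s) > 0)"
        using ae[of z]
        by (cases "z > 0") (auto elim: eventually_mono)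
    qed
    then have "prob {\<omega>\<in>space M. X 0 \<omega> > 0} = 0"
      using prob_T_X_eq_0_iff[of "\<lambda>\<tau> z. z > 0" 0] by simp
    then show False using prob_X_pos[of 0] by simp
  qed
  then obtain x0 where x0: "x0 > 0" "emeasure lborel (G x0) > 0" by blast
  obtain K where K: "compact K" "K \<subseteq> G x0" "emeasure lborel K > 0"
    by (rule inner_compact_pos[OF G x0(2)])
  obtain \<delta> where \<delta>: "\<delta> > 0" "\<And>h. \<bar>h\<bar> < \<delta> \<Longrightarrow> emeasure lborel {x \<in> K. x + h \<in> K} > 0"
    by (rule compact_shift_overlap[OF K(1,3)]) blast
  \<comment> \<open>Compactness of \<open>K\<close> bounds the waiting times of the jumps that are
    constructed.\<close>
  obtain B where B: "\<And>s. s \<in> K \<Longrightarrow> s \<le> B"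
    using compact_imp_bounded[OF K(1)] by (meson bounded_imp_bdd_above bdd_above.unfold)
  \<comment> \<open>The radius is \<open>c * \<delta>\<close> because moving the step size by
    \<open>c * h\<close> amounts to moving the waiting time by \<open>h\<close> inside
    \<open>f_Y\<close>.\<close>
  have "prob {\<omega>\<in>space M. \<bar>X i \<omega> - x\<bar> < \<eta> \<and> T i \<omega> \<le> B} > 0" if x: "\<bar>x - x0\<bar> < c * \<delta>" and \<eta>: "\<eta> > 0" for i x \<eta>
  proof -
    have "prob {\<omega>\<in>space M. \<bar>X i \<omega> - x\<bar> < \<eta> \<and> T i \<omega> \<le> B} \<noteq> 0"
    proof
      assume "prob {\<omega>\<in>space M. \<bar>X i \<omega> - x\<bar> < \<eta> \<and> T i \<omega> \<le> B} = 0"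
      then have ae: "AE z in lborel. AE s in lborel. \<not> ((\<bar>z - x\<bar> < \<eta> \<and> s \<le> B) \<and> f_T s > 0 \<and> f_Y (z + c * s) > 0)"
        using prob_T_X_eq_0_iff[of "\<lambda>s z. \<bar>z - x\<bar> < \<eta> \<and> s \<le> B" i] by simp
      define d where "d = min \<eta> (c * \<delta> - \<bar>x - x0\<bar>)"
      have d: "d > 0" using x \<eta> by (simp add: d_def)
      \<comment> \<open>An almost sure statement in \<open>z\<close> holds at some point of the
        interval of radius \<open>d\<close> around \<open>x\<close>, which has positive length;
        \<open>d\<close> is small enough for both requirements on \<open>z\<close>.\<close>
      have "\<exists>z. \<bar>z - x\<bar> < d \<and> (AE s in lborel. \<not> ((\<bar>z - x\<bar> < \<eta> \<and> s \<le> B) \<and> f_T s > 0 \<and> f_Y (z + c * s) > 0))"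
      proof (rule ccontr)
        assume "\<not> ?thesis"
        then have "AE z in lborel. z \<notin> {x - d<..<x + d}"
          using ae by (elim eventually_mono) (auto simp: abs_less_iff)
        then have "emeasure lborel {x - d<..<x + d} = 0"
          by (subst (asm) AE_iff_measurable[where N="{x - d<..<x + d}"]) auto
        then show False using d by simp
      qed
      then obtain z where z: "\<bar>z - x\<bar> < d"
        "AE s in lborel. \<not> ((\<bar>z - x\<bar> < \<eta> \<and> s \<le> B) \<and> f_T s > 0 \<and> f_Y (z + c * s) > 0)" by blast
      define h where "h = (z - x0) / c"
      have "\<bar>z - x0\<bar> < c * \<delta>" using z(1) unfolding d_def by linarith
      then have h: "\<bar>h\<bar> < \<delta>" using c_pos by (simp add: h_def field_simps)
      have "AE s in lborel. s \<notin> {s \<in> K. s + h \<in> K}"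
        using z(2)
      proof (rule eventually_mono)
        fix s assume s: "\<not> ((\<bar>z - x\<bar> < \<eta> \<and> s \<le> B) \<and> f_T s > 0 \<and> f_Y (z + c * s) > 0)"
        \<comment> \<open>Membership of \<open>s\<close> in \<open>K\<close> yields
          \<open>f_T s > 0\<close> and \<open>s \<le> B\<close>; membership of \<open>s + h\<close>
          yields positivity of \<open>f_Y\<close> at \<open>x0 + c * (s + h)\<close>, which is the
          argument needed for \<open>z\<close>.\<close>
        have "x0 + c * (s + h) = z + c * s" using c_pos by (simp add: h_def field_simps)
        then show "s \<notin> {s \<in> K. s + h \<in> K}"
          using s z(1) K(2) B by (auto simp: G_def d_def)
      qed
      moreover have "{s \<in> K. s + h \<in> K} \<in> sets borel"
      proof -
        have [measurable]: "K \<in> sets borel" using K(1) by (simp add: borel_compact)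
        show ?thesis by measurable
      qed
      ultimately have "emeasure lborel {s \<in> K. s + h \<in> K} = 0"
        by (subst (asm) AE_iff_measurable[where N="{s \<in> K. s + h \<in> K}"]) auto
      then show False using \<delta>(2)[OF h] by simp
    qed
    then show ?thesis by (simp add: zero_less_measure_iff)
  qed
  moreover have "c * \<delta> > 0" using c_pos \<delta>(1) by simp
  ultimately show ?thesis using that x0(1) by blast
qed

text \<open>Provides steps that let time pass without raising the walk. Waiting times are positive,
  so \<open>X 0 \<le> 0\<close> is the union of the events that also ask for
  \<open>T 0 \<ge> 1 / Suc n\<close>, and one of these is not null. Equal laws give the same bound
  for all \<open>i\<close>.\<close>

lemma long_nonpositive_step:
  obtains \<epsilon> where "\<epsilon> > 0" "\<forall>i. prob {\<omega>\<in>space M. X i \<omega> \<le> 0 \<and> T i \<omega> \<ge> \<epsilon>} > 0"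
proof -
  have "\<exists>n :: nat. prob {\<omega>\<in>space M. X 0 \<omega> \<le> 0 \<and> T 0 \<omega> \<ge> 1 / Suc n} \<noteq> 0"
  proof (rule ccontr)
    assume "\<not> ?thesis"
    then have "(\<Union>n :: nat. {\<omega>\<in>space M. X 0 \<omega> \<le> 0 \<and> T 0 \<omega> \<ge> 1 / Suc n}) \<in> null_sets M"
      by (intro null_sets_UN) (auto simp: null_sets_def emeasure_eq_measure)
    also have "(\<Union>n :: nat. {\<omega>\<in>space M. X 0 \<omega> \<le> 0 \<and> T 0 \<omega> \<ge> 1 / Suc n}) = {\<omega>\<in>space M. X 0 \<omega> \<le> 0}"
    proof (intro equalityI subsetI)
      fix \<omega> assume \<omega>: "\<omega> \<in> {\<omega>\<in>space M. X 0 \<omega> \<le> 0}"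
      then obtain n where "inverse (real (Suc n)) < T 0 \<omega>"
        using reals_Archimedean[OF T_pos] by blast
      then have "1 / Suc n \<le> T 0 \<omega>" by (simp add: inverse_eq_divide)
      then show "\<omega> \<in> (\<Union>n :: nat. {\<omega>\<in>space M. X 0 \<omega> \<le> 0 \<and> T 0 \<omega> \<ge> 1 / Suc n})"
        using \<omega> by blast
    qed auto
    finally show False using prob_X_nonpos[of 0] by (simp add: null_sets_def emeasure_eq_measure)
  qed
  then obtain n :: nat where n: "prob {\<omega>\<in>space M. X 0 \<omega> \<le> 0 \<and> T 0 \<omega> \<ge> 1 / Suc n} \<noteq> 0" by blast
  have "prob {\<omega>\<in>space M. X i \<omega> \<le> 0 \<and> T i \<omega> \<ge> 1 / Suc n} > 0" for i
  proof -
    let ?A = "{w \<in> space (borel \<Otimes>\<^sub>M borel). snd w - c * fst w \<le> 0 \<and> (fst w :: real) \<ge> 1 / Suc n}"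
    have "?A \<in> sets (borel \<Otimes>\<^sub>M borel)" by measurable
    from pairs.prob_eq[OF this, of i] n show ?thesis
      by (simp add: X_def space_pair_measure zero_less_measure_iff)
  qed
  then show ?thesis by (intro that[of "1 / Suc n"]) simp_all
qed

end

section \<open>Strict monotonicity of the crossing probability in the level\<close>

context claims_process
begin

text \<open>The level is crossed by \<open>k\<close> almost equal positive jumps that take the walk into \<open>(u, u')\<close>, after which it
  does not increase until time \<open>t\<close>.\<close>

lemma prob_crossing_strict:
  obtains K B where "\<And>t u u'. K \<le> u \<Longrightarrow> u < u' \<Longrightarrow> B * (u' + 1) \<le> t
      \<Longrightarrow> prob (crossing t u') < prob (crossing t u)"
proof -
  obtain x0 \<delta> B where x0: "x0 > 0" and \<delta>: "\<delta> > 0"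
    and jump: "\<forall>i x \<eta>. \<bar>x - x0\<bar> < \<delta> \<longrightarrow> \<eta> > 0 \<longrightarrow> prob {\<omega>\<in>space M. \<bar>X i \<omega> - x\<bar> < \<eta> \<and> T i \<omega> \<le> B} > 0"
    by (rule jump_interval)
  obtain \<epsilon> where \<epsilon>: "\<epsilon> > 0" and wait: "\<forall>i. prob {\<omega>\<in>space M. X i \<omega> \<le> 0 \<and> T i \<omega> \<ge> \<epsilon>} > 0"
    by (rule long_nonpositive_step)
  \<comment> \<open>With \<open>k\<close> the ceiling of \<open>v / x0\<close>, the jump size
    \<open>v / k\<close> is at most \<open>x0\<close> and falls short of it by less than
    \<open>x0\<^sup>2 / (v + x0)\<close>, which is below \<delta> once \<open>v\<close> exceeds this
    \<open>K\<close>.\<close>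
  define K where "K = x0\<^sup>2 / \<delta>"
  \<comment> \<open>At most \<open>u' / x0 + 1\<close> jumps, each lasting at most
    \<open>\<bar>B\<bar>\<close>, take time at most \<open>B' * (u' + 1)\<close>.\<close>
  define B' where "B' = \<bar>B\<bar> * (1 / x0 + 1)"
  have "prob (crossing t u') < prob (crossing t u)" if u: "K \<le> u" "u < u'" and t: "B' * (u' + 1) \<le> t" for t u u'
  proof -
    define v where "v = (u + u') / 2"
    have K: "K > 0" using x0 \<delta> by (simp add: K_def)
    have v: "u < v" "v < u'" "v > 0" using u K by (auto simp: v_def)
    define k where "k = nat \<lceil>v / x0\<rceil>"
    have k: "real k \<ge> v / x0" "real k < v / x0 + 1"
      using v(3) x0 by (auto simp: k_def) linarith+
    have "v / x0 > 0" using v(3) x0 by simp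
    then have k1: "k \<ge> 1" using k(1) by linarith
    have vk: "\<bar>v / k - x0\<bar> < \<delta>"
    proof -
      have "v / k \<le> x0" using k(1) k1 x0 by (simp add: field_simps)
      moreover have "x0 - \<delta> < v / k"
      proof -
        have "x0\<^sup>2 \<le> \<delta> * u" using u(1) \<delta> by (simp add: K_def field_simps)
        then have "x0\<^sup>2 < \<delta> * v" using mult_strict_left_mono[OF v(1) \<delta>] by linarith
        have "real k * x0 < v + x0" using k(2) x0 by (simp add: field_simps)
        show ?thesis
        proof (rule ccontr)
          assume "\<not> x0 - \<delta> < v / k"
          then have le: "v \<le> (x0 - \<delta>) * k" using k1 by (simp add: field_simps)
          have pos: "x0 - \<delta> > 0"
          proof (rule ccontr)
            assume "\<not> x0 - \<delta> > 0"
            then have "(x0 - \<delta>) * k \<le> 0" by (intro mult_nonpos_nonneg) auto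
            then show False using le v(3) by simp
          qed
          have "v * x0 \<le> (x0 - \<delta>) * (k * x0)" using mult_right_mono[OF le, of x0] x0 by (simp add: mult.assoc)
          also have "\<dots> < (x0 - \<delta>) * (v + x0)"
            using pos \<open>real k * x0 < v + x0\<close> by (intro mult_strict_left_mono)
          also have "\<dots> = v * x0 - (\<delta> * v - x0\<^sup>2) - \<delta> * x0" by (simp add: algebra_simps power2_eq_square)
          also have "\<dots> < v * x0" using \<open>x0\<^sup>2 < \<delta> * v\<close> mult_pos_pos[OF \<delta> x0] by linarith
          finally show False .
        qed
      qed
      ultimately show ?thesis using \<delta> by linarith
    qed
    \<comment> \<open>The first bound keeps \<open>S k\<close> within half the gap of the midpoint
      \<open>v\<close>; the second keeps each jump positive, so that the walk does not exceed
      \<open>S k\<close> on its way up.\<close>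
    define \<eta> where "\<eta> = min ((u' - u) / (2 * k)) (v / k)"
    have \<eta>: "\<eta> > 0" "k * \<eta> \<le> (u' - u) / 2" "\<eta> \<le> v / k"
    proof -
      show "\<eta> > 0" "\<eta> \<le> v / k" using u v k1 by (auto simp: \<eta>_def)
      have "\<eta> \<le> (u' - u) / (2 * k)" by (simp add: \<eta>_def)
      then show "k * \<eta> \<le> (u' - u) / 2" using k1 by (simp add: field_simps)
    qed
    \<comment> \<open>So many waiting steps that time \<open>t\<close> has passed before they are
      used up.\<close>
    obtain m :: nat where m: "real m * \<epsilon> > t" using \<epsilon> by (metis reals_Archimedean3)
    define A where "A i = (if i < k then {w \<in> space (borel \<Otimes>\<^sub>M borel). \<bar>snd w - c * fst w - v / k\<bar> < \<eta> \<and> fst w \<le> B}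
      else {w \<in> space (borel \<Otimes>\<^sub>M borel). snd w - c * fst w \<le> 0 \<and> fst w \<ge> \<epsilon>})" for i
    have A_sets: "A i \<in> sets (borel \<Otimes>\<^sub>M borel)" for i
    proof (cases "i < k")
      case True
      then show ?thesis unfolding A_def by (simp only: if_True) measurable
    next
      case False
      then show ?thesis unfolding A_def by (simp only: if_False) measurable
    qed
    have A_prob: "prob ((\<lambda>\<omega>. (T i \<omega>, Y i \<omega>)) -` A i \<inter> space M) > 0" for i
    proof (cases "i < k")
      case True
      then have "(\<lambda>\<omega>. (T i \<omega>, Y i \<omega>)) -` A i \<inter> space M = {\<omega>\<in>space M. \<bar>X i \<omega> - v / k\<bar> < \<eta> \<and> T i \<omega> \<le> B}"
        by (auto simp: A_def X_def space_pair_measure)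
      then show ?thesis using jump vk \<eta>(1) by simp
    next
      case False
      then have "(\<lambda>\<omega>. (T i \<omega>, Y i \<omega>)) -` A i \<inter> space M = {\<omega>\<in>space M. X i \<omega> \<le> 0 \<and> T i \<omega> \<ge> \<epsilon>}"
        by (auto simp: A_def X_def space_pair_measure)
      then show ?thesis using wait by simp
    qed
    let ?F = "\<Inter>i\<in>{..<k+m}. (\<lambda>\<omega>. (T i \<omega>, Y i \<omega>)) -` A i \<inter> space M"
    have "prob ?F = (\<Prod>i\<in>{..<k+m}. prob ((\<lambda>\<omega>. (T i \<omega>, Y i \<omega>)) -` A i \<inter> space M))"
      by (rule indep_varsD[OF pairs.indep]) (use k1 A_sets in \<open>auto simp: lessThan_empty_iff\<close>)
    also have "\<dots> > 0" using A_prob by (intro prod_pos) auto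
    finally have F_pos: "prob ?F > 0" .
    have "?F \<subseteq> crossing t u - crossing t u'"
    proof
      fix \<omega> assume F: "\<omega> \<in> ?F"
      have \<omega>: "\<omega> \<in> space M" using INT_D[OF F, of 0] k1 by simp
      have up: "\<bar>X i \<omega> - v / k\<bar> < \<eta>" "T i \<omega> \<le> B" if "i < k" for i
        using INT_D[OF F, of i] that by (auto simp: A_def X_def)
      have stay: "X i \<omega> \<le> 0" "T i \<omega> \<ge> \<epsilon>" if "k \<le> i" "i < k + m" for i
        using INT_D[OF F, of i] that by (auto simp: A_def X_def)
      have X_pos: "X i \<omega> > 0" if "i < k" for i
        using up(1)[OF that] \<eta>(3) by linarith
      have "\<bar>S k \<omega> - v\<bar> < k * \<eta>"
      proof -
        have "S k \<omega> - v = (\<Sum>i<k. X i \<omega> - v / k)" using k1 by (simp add: sum_subtractf)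
        also have "\<bar>\<dots>\<bar> \<le> (\<Sum>i<k. \<bar>X i \<omega> - v / k\<bar>)" by (rule sum_abs)
        also have "\<dots> < (\<Sum>i<k. \<eta>)" using k1 up(1) by (intro sum_strict_mono) (auto simp: lessThan_empty_iff)
        finally show ?thesis by simp
      qed
      then have Sk: "u < S k \<omega>" "S k \<omega> < u'" using \<eta>(2) by (auto simp: v_def field_simps)
      have "\<tau> k \<omega> \<le> (\<Sum>i<k. \<bar>B\<bar>)" using up(2) by (intro sum_mono) (force intro: order.trans)
      also have "\<dots> \<le> (u' / x0 + 1) * \<bar>B\<bar>"
      proof -
        have "v / x0 \<le> u' / x0" using v(2) x0 by (simp add: divide_right_mono)
        then have "real k \<le> u' / x0 + 1" using k(2) by linarith
        then show ?thesis by (simp add: mult_right_mono)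
      qed
      also have "\<dots> \<le> B' * (u' + 1)"
      proof -
        have "u' / x0 + 1 \<le> (1 / x0 + 1) * (u' + 1)" using x0 v by (simp add: field_simps)
        then show ?thesis unfolding B'_def using mult_right_mono[of "u' / x0 + 1" "(1 / x0 + 1) * (u' + 1)" "\<bar>B\<bar>"]
          by (simp add: mult_ac)
      qed
      also have "\<dots> \<le> t" by (rule t)
      finally have "\<tau> k \<omega> \<le> t" .
      then have "\<omega> \<in> crossing t u" using \<omega> k1 Sk(1) unfolding crossing_def by blast
      moreover have "\<omega> \<notin> crossing t u'"
      proof
        assume "\<omega> \<in> crossing t u'"
        then obtain n where n: "n \<ge> 1" "\<tau> n \<omega> \<le> t" "S n \<omega> > u'" by (auto simp: crossing_def)
        have "n < k + m"
        proof (rule ccontr)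
          assume "\<not> n < k + m"
          then have "\<tau> (k + m) \<omega> \<le> \<tau> n \<omega>" by (intro tau_mono \<omega>) simp
          moreover have "\<tau> (k + m) \<omega> = \<tau> k \<omega> + (\<Sum>i=k..<k+m. T i \<omega>)"
            using sum.atLeastLessThan_concat[of 0 k "k+m" "\<lambda>i. T i \<omega>"] by (simp add: atLeast0LessThan)
          moreover have "(\<Sum>i=k..<k+m. \<epsilon>) \<le> (\<Sum>i=k..<k+m. T i \<omega>)" using stay(2) by (intro sum_mono) auto
          moreover have "\<tau> k \<omega> \<ge> 0" using T_pos[OF \<omega>] by (intro sum_nonneg) (auto intro: less_imp_le)
          ultimately show False using m n(2) by simp
        qed
        have "S n \<omega> \<le> S k \<omega>"
        proof (cases "n \<le> k")
          case True
          then show ?thesis using X_pos by (intro sum_mono2) (auto intro: less_imp_le)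
        next
          case False
          then have "S n \<omega> = S k \<omega> + (\<Sum>i=k..<n. X i \<omega>)"
            using sum.atLeastLessThan_concat[of 0 k n "\<lambda>i. X i \<omega>"] by (simp add: atLeast0LessThan)
          moreover have "(\<Sum>i=k..<n. X i \<omega>) \<le> 0" using stay(1) \<open>n < k + m\<close> by (intro sum_nonpos) auto
          ultimately show ?thesis by simp
        qed
        then show False using n(3) Sk(2) by simp
      qed
      ultimately show "\<omega> \<in> crossing t u - crossing t u'" by blast
    qed
    then have "0 < prob (crossing t u - crossing t u')"
      using F_pos by (meson finite_measure_mono less_le_trans sets.Diff sets_crossing)
    also have "\<dots> = prob (crossing t u) - prob (crossing t u')"
      using u(2) by (intro finite_measure_Diff) (force simp: crossing_def)+
    finally show ?thesis by simp
  qed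
  then show ?thesis by (rule that)
qed

section \<open>Crossing probabilities at levels of order \<open>sqrt t\<close>\<close>

lemma normal_tail_tendsto_right: "((\<lambda>x. 2 * normal_tail (x / \<sigma>)) \<longlongrightarrow> 2 * normal_tail (x / \<sigma>)) (at_right x)"
  and normal_tail_tendsto_left: "((\<lambda>x. 2 * normal_tail (x / \<sigma>)) \<longlongrightarrow> 2 * normal_tail (x / \<sigma>)) (at_left x)"
proof -
  have "isCont (\<lambda>x. 2 * normal_tail (x / \<sigma>)) x"
    using sigma_pos by (intro continuous_intros isCont_o2[OF _ isCont_cdf_std_normal]) auto
  then show "((\<lambda>x. 2 * normal_tail (x / \<sigma>)) \<longlongrightarrow> 2 * normal_tail (x / \<sigma>)) (at_right x)"
    "((\<lambda>x. 2 * normal_tail (x / \<sigma>)) \<longlongrightarrow> 2 * normal_tail (x / \<sigma>)) (at_left x)"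
    by (auto simp: isCont_def filterlim_at_split)
qed

text \<open>Compares the random number of renewals with a deterministic \<open>m t\<close> slightly
  above \<open>t / \<mu>\<close>. Unless the epoch with index \<open>m t\<close> is atypically
  early, a crossing uses at most \<open>m t\<close> steps, so the law of the maximum over
  \<open>m t\<close> steps applies.\<close>

lemma eventually_prob_crossing_less:
  assumes y: "y > 0" and a: "2 * normal_tail (y * sqrt \<mu> / \<sigma>) < a"
  shows "eventually (\<lambda>t. prob (crossing t (y * sqrt t)) < a) at_top"
proof -
  have \<mu>: "\<mu> > 0" by (rule expectation_pos)
  have "eventually (\<lambda>x. 2 * normal_tail (x / \<sigma>) < a) (at_left (y * sqrt \<mu>))"
    by (rule order_tendstoD(2)[OF normal_tail_tendsto_left a])
  moreover have "eventually (\<lambda>x. x \<in> {0<..<y * sqrt \<mu>}) (at_left (y * sqrt \<mu>))"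
    using y \<mu> by (intro eventually_at_leftI) auto
  ultimately have "eventually (\<lambda>x. 2 * normal_tail (x / \<sigma>) < a \<and> x \<in> {0<..<y * sqrt \<mu>}) (at_left (y * sqrt \<mu>))"
    by (rule eventually_conj)
  then obtain x where x: "2 * normal_tail (x / \<sigma>) < a" "0 < x" "x < y * sqrt \<mu>"
    using eventually_happens'[OF trivial_limit_at_left_real] by force
  \<comment> \<open>Chosen so that \<open>x * sqrt (q * t) = y * sqrt t\<close>; the slack
    \<open>x < y * sqrt \<mu>\<close> becomes \<open>q > 1 / \<mu>\<close>.\<close>
  define q where "q = (y / x)\<^sup>2"
  have sqrt_q: "sqrt q = y / x" using x y by (simp add: q_def)
  have q: "q > 0" "q * \<mu> > 1"
  proof -
    show "q > 0" using x y by (simp add: q_def)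
    have "x\<^sup>2 < (y * sqrt \<mu>)\<^sup>2" using x by (intro power_strict_mono) auto
    then show "q * \<mu> > 1" using x \<mu> by (simp add: q_def field_simps power_mult_distrib)
  qed
  \<comment> \<open>Half the gap between \<mu> and \<open>1 / q\<close>, hence
    \<open>(\<mu> - e) * q\<close> is the mean of \<open>\<mu> * q\<close> and 1. Rounding in
    \<open>m t\<close> may lose one step, which this strict excess over 1 pays for when
    \<open>t\<close> is large.\<close>
  define e where "e = (\<mu> - 1 / q) / 2"
  have e: "e > 0" "(\<mu> - e) * q > 1"
    using q by (auto simp: e_def field_simps)
  define m where "m t = nat \<lfloor>q * t\<rfloor>" for t
  have m: "filterlim m at_top at_top"
    unfolding m_def using q(1) by real_asymp
  have "((\<lambda>t. prob (exceeds (m t) (x * sqrt (m t))) + prob {\<omega>\<in>space M. \<tau> (m t) \<omega> \<le> (\<mu> - e) * m t})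
      \<longlongrightarrow> 2 * normal_tail (x / \<sigma>) + 0) at_top"
    using filterlim_compose[OF prob_exceeds_tendsto m] filterlim_compose[OF prob_tau_le_tendsto_0[OF e(1)] m] x
    by (intro tendsto_add) auto
  then have "eventually (\<lambda>t. prob (exceeds (m t) (x * sqrt (m t))) + prob {\<omega>\<in>space M. \<tau> (m t) \<omega> \<le> (\<mu> - e) * m t} < a) at_top"
    using order_tendstoD(2) x(1) by force
  moreover have "eventually (\<lambda>t. t \<le> (\<mu> - e) * (q * t - 1)) at_top"
    using eventually_ge_at_top[of "(\<mu> - e) / ((\<mu> - e) * q - 1)"]
  proof eventually_elim
    case (elim t)
    then have "\<mu> - e \<le> t * ((\<mu> - e) * q - 1)"
      using e(2) by (simp add: pos_divide_le_eq)
    then show ?case by (simp add: algebra_simps)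
  qed
  ultimately show ?thesis using eventually_ge_at_top[of 0]
  proof eventually_elim
    case (elim t)
    have mt: "real (m t) \<le> q * t" "real (m t) \<ge> q * t - 1"
      using elim(3) q(1) unfolding m_def by (simp, linarith)
    have "\<mu> - e > 0" using e(2) q(1) by (metis less_trans zero_less_mult_pos2 zero_less_one)
    then have "(\<mu> - e) * (q * t - 1) \<le> (\<mu> - e) * m t" using mt(2) by (intro mult_left_mono) auto
    then have t: "t \<le> (\<mu> - e) * m t" using elim(2) by simp
    have "x * sqrt (m t) \<le> x * sqrt (q * t)" using mt(1) x by simp
    also have "\<dots> = y * sqrt t" using x by (simp add: real_sqrt_mult sqrt_q)
    finally have le: "x * sqrt (m t) \<le> y * sqrt t" .
    have "crossing t (y * sqrt t) \<subseteq> exceeds (m t) (x * sqrt (m t)) \<union> {\<omega>\<in>space M. \<tau> (m t) \<omega> \<le> (\<mu> - e) * m t}"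
    proof
      fix \<omega> assume "\<omega> \<in> crossing t (y * sqrt t)"
      then obtain n where n: "\<omega> \<in> space M" "n \<ge> 1" "\<tau> n \<omega> \<le> t" "S n \<omega> > y * sqrt t" by (auto simp: crossing_def)
      show "\<omega> \<in> exceeds (m t) (x * sqrt (m t)) \<union> {\<omega>\<in>space M. \<tau> (m t) \<omega> \<le> (\<mu> - e) * m t}"
      proof (cases "n \<le> m t")
        case True
        have "S n \<omega> > x * sqrt (m t)" using n(4) le by linarith
        moreover have "n \<in> {1..m t}" using True n(2) by simp
        ultimately have "\<omega> \<in> exceeds (m t) (x * sqrt (m t))" using n(1) unfolding exceeds_def by blast
        then show ?thesis by blast
      next
        case False
        then have "\<tau> (m t) \<omega> \<le> t" using tau_mono[OF n(1), of "m t" n] n(3) by simp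
        then show ?thesis using t n(1) by auto
      qed
    qed
    then have "prob (crossing t (y * sqrt t)) \<le> prob (exceeds (m t) (x * sqrt (m t)) \<union> {\<omega>\<in>space M. \<tau> (m t) \<omega> \<le> (\<mu> - e) * m t})"
      by (rule finite_measure_mono) measurable
    also have "\<dots> \<le> prob (exceeds (m t) (x * sqrt (m t))) + prob {\<omega>\<in>space M. \<tau> (m t) \<omega> \<le> (\<mu> - e) * m t}"
      by (rule measure_Un_le) measurable
    finally show ?case using elim(1) by simp
  qed
qed

text \<open>The same comparison from below: \<open>m t\<close> is slightly less than
  \<open>t / \<mu>\<close>, so the first \<open>m t\<close> renewals have typically occurred by time
  \<open>t\<close>.\<close>

lemma eventually_prob_crossing_greater:
  assumes y: "y > 0" and a: "a < 2 * normal_tail (y * sqrt \<mu> / \<sigma>)"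
  shows "eventually (\<lambda>t. a < prob (crossing t (y * sqrt t))) at_top"
proof -
  have \<mu>: "\<mu> > 0" by (rule expectation_pos)
  have "eventually (\<lambda>x. a < 2 * normal_tail (x / \<sigma>)) (at_right (y * sqrt \<mu>))"
    by (rule order_tendstoD(1)[OF normal_tail_tendsto_right a])
  moreover have "eventually (\<lambda>x. x > y * sqrt \<mu>) (at_right (y * sqrt \<mu>))"
    by (rule eventually_at_right_less)
  ultimately have "eventually (\<lambda>x. a < 2 * normal_tail (x / \<sigma>) \<and> x > y * sqrt \<mu>) (at_right (y * sqrt \<mu>))"
    by (rule eventually_conj)
  then obtain x where x: "a < 2 * normal_tail (x / \<sigma>)" "x > y * sqrt \<mu>"
    using eventually_happens'[OF trivial_limit_at_right_real] by force
  have x0: "x > 0" using x(2) y \<mu> by (smt (verit) mult_pos_pos real_sqrt_gt_zero)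
  define q where "q = (y / x)\<^sup>2"
  have sqrt_q: "sqrt q = y / x" using x0 y by (simp add: q_def)
  have q: "q > 0" "q * \<mu> < 1"
  proof -
    show "q > 0" using x0 y by (simp add: q_def)
    have "(y * sqrt \<mu>)\<^sup>2 < x\<^sup>2" using x y \<mu> by (intro power_strict_mono) auto
    then show "q * \<mu> < 1" using x0 \<mu> by (simp add: q_def field_simps power_mult_distrib)
  qed
  define e where "e = (1 / q - \<mu>) / 2"
  have e: "e > 0" "(\<mu> + e) * q < 1"
    using q by (auto simp: e_def field_simps)
  \<comment> \<open>Rounding goes up here, since \<open>x * sqrt (m t)\<close> has to dominate
    \<open>y * sqrt t\<close>.\<close>
  define m where "m t = nat \<lceil>q * t\<rceil>" for t
  have m: "filterlim m at_top at_top"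
    unfolding m_def using q(1) by real_asymp
  have "((\<lambda>t. prob (exceeds (m t) (x * sqrt (m t))) - prob {\<omega>\<in>space M. \<tau> (m t) \<omega> > (\<mu> + e) * m t})
      \<longlongrightarrow> 2 * normal_tail (x / \<sigma>) - 0) at_top"
    using filterlim_compose[OF prob_exceeds_tendsto m] filterlim_compose[OF prob_tau_gt_tendsto_0[OF e(1)] m] x0
    by (intro tendsto_diff) auto
  then have "eventually (\<lambda>t. a < prob (exceeds (m t) (x * sqrt (m t))) - prob {\<omega>\<in>space M. \<tau> (m t) \<omega> > (\<mu> + e) * m t}) at_top"
    using order_tendstoD(1) x(1) by force
  moreover have "eventually (\<lambda>t. (\<mu> + e) * (q * t + 1) \<le> t) at_top"
    using eventually_ge_at_top[of "(\<mu> + e) / (1 - (\<mu> + e) * q)"]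
  proof eventually_elim
    case (elim t)
    then have "\<mu> + e \<le> t * (1 - (\<mu> + e) * q)"
      using e(2) by (simp add: pos_divide_le_eq)
    then show ?case by (simp add: algebra_simps)
  qed
  ultimately show ?thesis using eventually_ge_at_top[of 0]
  proof eventually_elim
    case (elim t)
    have "q * t \<ge> 0" using elim(3) q(1) by simp
    then have mt: "real (m t) \<ge> q * t" "real (m t) \<le> q * t + 1"
      unfolding m_def by linarith+
    have "(\<mu> + e) * m t \<le> (\<mu> + e) * (q * t + 1)" using mt(2) \<mu> e(1) by (intro mult_left_mono) auto
    then have t: "(\<mu> + e) * m t \<le> t" using elim(2) by simp
    have "y * sqrt t = x * sqrt (q * t)" using x0 by (simp add: real_sqrt_mult sqrt_q)
    also have "\<dots> \<le> x * sqrt (m t)" using mt(1) x0 by simp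
    finally have le: "y * sqrt t \<le> x * sqrt (m t)" .
    have "exceeds (m t) (x * sqrt (m t)) \<subseteq> crossing t (y * sqrt t) \<union> {\<omega>\<in>space M. \<tau> (m t) \<omega> > (\<mu> + e) * m t}"
    proof
      fix \<omega> assume "\<omega> \<in> exceeds (m t) (x * sqrt (m t))"
      then obtain n where n: "\<omega> \<in> space M" "n \<ge> 1" "n \<le> m t" "S n \<omega> > x * sqrt (m t)" by (auto simp: exceeds_def)
      show "\<omega> \<in> crossing t (y * sqrt t) \<union> {\<omega>\<in>space M. \<tau> (m t) \<omega> > (\<mu> + e) * m t}"
      proof (cases "\<tau> (m t) \<omega> \<le> t")
        case True
        then have "\<tau> n \<omega> \<le> t" using tau_mono[OF n(1,3)] by simp
        moreover have "S n \<omega> > y * sqrt t" using n(4) le by linarith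
        ultimately have "\<omega> \<in> crossing t (y * sqrt t)" using n(1,2) unfolding crossing_def by blast
        then show ?thesis by blast
      next
        case False
        then show ?thesis using t n(1) by auto
      qed
    qed
    then have "prob (exceeds (m t) (x * sqrt (m t))) \<le> prob (crossing t (y * sqrt t) \<union> {\<omega>\<in>space M. \<tau> (m t) \<omega> > (\<mu> + e) * m t})"
      by (rule finite_measure_mono) measurable
    also have "\<dots> \<le> prob (crossing t (y * sqrt t)) + prob {\<omega>\<in>space M. \<tau> (m t) \<omega> > (\<mu> + e) * m t}"
      by (rule measure_Un_le) measurable
    finally show ?case using elim(1) by simp
  qed
qed

end

section \<open>The crossing time\<close>

text \<open>The count stays the same until the next renewal epoch. It is proved for every outcome
  with positive waiting times, including bounded partial sums, so that the reductions below are
  pointwise and measurability needs no null set.\<close>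

lemma renewal_count_right_constant:
  fixes T :: "nat \<Rightarrow> 'a \<Rightarrow> real"
  assumes T: "\<And>i. T i \<omega> > 0"
  obtains \<epsilon> where "\<epsilon> > 0" "\<And>s'. s \<le> s' \<Longrightarrow> s' < s + \<epsilon> \<Longrightarrow> renewal_count T s' \<omega> = renewal_count T s \<omega>"
proof -
  have mono: "(\<Sum>i<m. T i \<omega>) \<le> (\<Sum>i<n. T i \<omega>)" if "m \<le> n" for m n
    using that T by (intro sum_mono2) (auto intro: less_imp_le)
  consider "T 0 \<omega> > s" | "T 0 \<omega> \<le> s" "\<forall>n. (\<Sum>i<n. T i \<omega>) \<le> s" | N where "T 0 \<omega> \<le> s" "(\<Sum>i<N. T i \<omega>) > s"
    by (meson not_le)
  then show ?thesis
  proof cases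
    case 1
    then show ?thesis by (intro that[of "T 0 \<omega> - s"]) (auto simp: renewal_count_def)
  next
    \<comment> \<open>Here \<open>Max\<close> is taken over an infinite set and its value is
      unspecified, but the set is the same for all \<open>s' \<ge> s\<close>.\<close>
    case 2
    have eq: "renewal_count T s' \<omega> = renewal_count T s \<omega>" if "s \<le> s'" for s'
    proof -
      have "\<forall>n. (\<Sum>i<n. T i \<omega>) \<le> s'" "T 0 \<omega> \<le> s'" using 2 that by (auto intro: order.trans)
      then show ?thesis using 2 by (simp add: renewal_count_def)
    qed
    show ?thesis by (rule that[OF zero_less_one]) (rule eq)
  next
    case 3
    define n where "n = (LEAST n. (\<Sum>i<n. T i \<omega>) > s)"
    have n: "(\<Sum>i<n. T i \<omega>) > s" 
      unfolding n_def by (rule LeastI[of "\<lambda>n. (\<Sum>i<n. T i \<omega>) > s" N]) (rule 3(2))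
    have least: "(\<Sum>i<m. T i \<omega>) \<le> s" if "m < n" for m
      using not_less_Least[of m "\<lambda>n. (\<Sum>i<n. T i \<omega>) > s"] that by (auto simp: n_def not_less)
    show ?thesis
    proof (rule that[of "(\<Sum>i<n. T i \<omega>) - s"])
      fix s' assume s': "s \<le> s'" "s' < s + ((\<Sum>i<n. T i \<omega>) - s)"
      have "(\<Sum>i<m. T i \<omega>) \<le> s' \<longleftrightarrow> (\<Sum>i<m. T i \<omega>) \<le> s" for m
      proof (cases "m < n")
        case True
        then show ?thesis using least[OF True] s' by simp
      next
        case False
        then show ?thesis using mono[of n m] n s' by simp
      qed
      then show "renewal_count T s' \<omega> = renewal_count T s \<omega>"
        using 3(1) s' by (simp add: renewal_count_def)
    qed (use n in simp)
  qed
qed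

lemma renewal_count_at_renewal:
  fixes T :: "nat \<Rightarrow> 'a \<Rightarrow> real"
  assumes T: "\<And>i. T i \<omega> > 0" and n: "n \<ge> 1"
  shows "renewal_count T (\<Sum>i<n. T i \<omega>) \<omega> = n"
proof -
  have mono: "(\<Sum>i<k. T i \<omega>) \<le> (\<Sum>i<l. T i \<omega>)" if "k \<le> l" for k l
    using that T by (intro sum_mono2) (auto intro: less_imp_le)
  have iff: "(\<Sum>i<m. T i \<omega>) \<le> (\<Sum>i<n. T i \<omega>) \<longleftrightarrow> m \<le> n" for m
  proof (cases "m \<le> n")
    case False
    then have "(\<Sum>i<n. T i \<omega>) + T n \<omega> \<le> (\<Sum>i<m. T i \<omega>)"
      using mono[of "Suc n" m] by simp
    then show ?thesis using False T[of n] by linarith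
  qed (simp add: mono)
  have "{m. m \<ge> 1 \<and> (\<Sum>i<m. T i \<omega>) \<le> (\<Sum>i<n. T i \<omega>)} = {1..n}"
    unfolding iff by auto
  moreover have "\<not> T 0 \<omega> > (\<Sum>i<n. T i \<omega>)"
    using mono[of 1 n] n by simp
  moreover have "Max {1..n} = n"
    using n by (intro Max_eqI) auto
  ultimately show ?thesis
    by (simp only: renewal_count_def if_False)
qed

text \<open>The infimum need not be attained, so crossings just after \<open>t\<close> could bring
  it down to \<open>t\<close>. But the count is constant right after \<open>t\<close> and the drift
  only lowers the process, so such a crossing forces one at \<open>t\<close> itself.\<close>

lemma crossing_time_le_iff:
  fixes T Y :: "nat \<Rightarrow> 'a \<Rightarrow> real"
  assumes T: "\<And>i. T i \<omega> > 0" and c: "c \<ge> 0" and t: "t > 0"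
  shows "crossing_time T Y u c \<omega> \<le> ereal t \<longleftrightarrow> (\<exists>s. 0 < s \<and> s \<le> t \<and> compound_renewal T Y s \<omega> - c * s > u)"
proof
  assume le: "crossing_time T Y u c \<omega> \<le> ereal t"
  show "\<exists>s. 0 < s \<and> s \<le> t \<and> compound_renewal T Y s \<omega> - c * s > u"
  proof (rule ccontr)
    assume none: "\<not> ?thesis"
    obtain \<epsilon> where \<epsilon>: "\<epsilon> > 0" "\<And>s'. t \<le> s' \<Longrightarrow> s' < t + \<epsilon> \<Longrightarrow> renewal_count T s' \<omega> = renewal_count T t \<omega>"
      by (rule renewal_count_right_constant[of T \<omega> t, OF T]) blast
    have "t + \<epsilon> \<le> s" if s: "s > 0" "compound_renewal T Y s \<omega> - c * s > u" for s
    proof (rule ccontr)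
      assume "\<not> t + \<epsilon> \<le> s"
      moreover have "t < s" using none s by (meson not_le)
      ultimately have "compound_renewal T Y s \<omega> = compound_renewal T Y t \<omega>"
        using \<epsilon>(2)[of s] by (simp add: compound_renewal_def)
      moreover have "c * t \<le> c * s" using c \<open>t < s\<close> by (intro mult_left_mono) auto
      ultimately have "compound_renewal T Y t \<omega> - c * t > u" using s(2) by linarith
      then show False using none t by blast
    qed
    then have "ereal (t + \<epsilon>) \<le> crossing_time T Y u c \<omega>"
      unfolding crossing_time_def by (intro Inf_greatest) auto
    then have "ereal (t + \<epsilon>) \<le> ereal t" using le by (rule order.trans)
    then show False using \<epsilon>(1) by simp
  qed
next
  assume "\<exists>s. 0 < s \<and> s \<le> t \<and> compound_renewal T Y s \<omega> - c * s > u"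
  then obtain s where s: "0 < s" "s \<le> t" "compound_renewal T Y s \<omega> - c * s > u" by blast
  then have "crossing_time T Y u c \<omega> \<le> ereal s"
    unfolding crossing_time_def by (intro Inf_lower) auto
  also have "\<dots> \<le> ereal t" using s by simp
  finally show "crossing_time T Y u c \<omega> \<le> ereal t" .
qed

text \<open>Makes the event a countable union, for measurability. A crossing at \<open>s < t\<close>
  persists at a rational slightly later, where the drift has not yet consumed the excess over
  \<open>u\<close>; at \<open>t\<close> there is no room to the right, so \<open>t\<close> is
  added.\<close>

lemma compound_renewal_exceeds_iff_countable:
  fixes T Y :: "nat \<Rightarrow> 'a \<Rightarrow> real"
  assumes T: "\<And>i. T i \<omega> > 0" and c: "c > 0" and t: "t > 0"
  shows "(\<exists>s. 0 < s \<and> s \<le> t \<and> compound_renewal T Y s \<omega> - c * s > u) \<longleftrightarrow>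
    (\<exists>s\<in>insert t (\<rat> \<inter> {0<..<t}). compound_renewal T Y s \<omega> - c * s > u)"
proof
  assume "\<exists>s. 0 < s \<and> s \<le> t \<and> compound_renewal T Y s \<omega> - c * s > u"
  then obtain s where s: "0 < s" "s \<le> t" "compound_renewal T Y s \<omega> - c * s > u" by blast
  show "\<exists>s\<in>insert t (\<rat> \<inter> {0<..<t}). compound_renewal T Y s \<omega> - c * s > u"
  proof (cases "s = t")
    case False
    obtain \<epsilon> where \<epsilon>: "\<epsilon> > 0" "\<And>s'. s \<le> s' \<Longrightarrow> s' < s + \<epsilon> \<Longrightarrow> renewal_count T s' \<omega> = renewal_count T s \<omega>"
      by (rule renewal_count_right_constant[of T \<omega> s, OF T]) blast
    define d where "d = min \<epsilon> (min (t - s) ((compound_renewal T Y s \<omega> - c * s - u) / c))"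
    have "d > 0" using \<epsilon> s c False by (simp add: d_def)
    then obtain r where r: "r \<in> \<rat>" "s < r" "r < s + d" using Rats_dense_in_real[of s "s + d"] by auto
    have "r - s < (compound_renewal T Y s \<omega> - c * s - u) / c" using r(3) by (simp add: d_def)
    then have "(r - s) * c < compound_renewal T Y s \<omega> - c * s - u" using c by (simp add: pos_less_divide_eq)
    moreover have "compound_renewal T Y r \<omega> = compound_renewal T Y s \<omega>"
      using \<epsilon>(2)[of r] r by (simp add: compound_renewal_def d_def)
    ultimately have "compound_renewal T Y r \<omega> - c * r > u" by (simp add: algebra_simps)
    moreover have "r \<in> \<rat> \<inter> {0<..<t}" using r s by (simp add: d_def)
    ultimately show ?thesis by blast
  qed (use s in blast)
qed (use t in force)

lemma borel_measurable_compound_renewal: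
  fixes T Y :: "nat \<Rightarrow> 'a \<Rightarrow> real"
  assumes [measurable]: "\<And>i. T i \<in> borel_measurable M" "\<And>i. Y i \<in> borel_measurable M"
  shows "compound_renewal T Y s \<in> borel_measurable M"
proof -
  have [measurable]: "renewal_count T s \<in> measurable M (count_space UNIV)"
    unfolding renewal_count_def by measurable
  have "(\<lambda>\<omega>. (\<lambda>n \<omega>. \<Sum>i<n. Y i \<omega>) (renewal_count T s \<omega>) \<omega>) \<in> borel_measurable M"
    by (rule measurable_compose_countable) measurable
  then show ?thesis by (simp add: compound_renewal_def[abs_def])
qed

section \<open>From the crossing time to the asymptotics of the level\<close>

context claims_process
begin

text \<open>Moving a crossing time back to the last renewal epoch keeps the sum of the jumps and
  reduces the drift, so the process can only be larger there.\<close>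

lemma prob_crossing_time_le:
  assumes t: "t > 0" and u: "u \<ge> 0"
  shows "prob {\<omega>\<in>space M. crossing_time T Y u c \<omega> \<le> ereal t} = prob (crossing t u)"
proof (rule finite_measure_eq_AE)
  let ?V = "compound_renewal T Y"
  have iff: "crossing_time T Y u c \<omega> \<le> ereal t \<longleftrightarrow> (\<exists>s. 0 < s \<and> s \<le> t \<and> ?V s \<omega> - c * s > u)"
    if "\<omega> \<in> space M" for \<omega>
    using that T_pos c_pos t by (intro crossing_time_le_iff) (auto intro: less_imp_le)
  have "{\<omega>\<in>space M. crossing_time T Y u c \<omega> \<le> ereal t}
      = (\<Union>s\<in>insert t (\<rat> \<inter> {0<..<t}). {\<omega>\<in>space M. ?V s \<omega> - c * s > u})"
  proof -
    have "crossing_time T Y u c \<omega> \<le> ereal t \<longleftrightarrow> (\<exists>s\<in>insert t (\<rat> \<inter> {0<..<t}). ?V s \<omega> - c * s > u)"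
      if "\<omega> \<in> space M" for \<omega>
      unfolding iff[OF that] using that T_pos c_pos t by (intro compound_renewal_exceeds_iff_countable) auto
    then show ?thesis by blast
  qed
  also have "\<dots> \<in> sets M"
  proof (rule sets.countable_UN'')
    note borel_measurable_compound_renewal[measurable]
    show "{\<omega>\<in>space M. ?V s \<omega> - c * s > u} \<in> sets M" for s
      by measurable
  qed (auto intro: countable_rat countable_Int1)
  finally show "{\<omega>\<in>space M. crossing_time T Y u c \<omega> \<le> ereal t} \<in> sets M" .
  \<comment> \<open>Infinitely many renewals by time \<open>t\<close> would make \<open>Max\<close>
    meaningless; this event lies in every \<open>{\<tau> n \<le> t}\<close> and is therefore
    null.\<close>
  have "prob {\<omega>\<in>space M. \<forall>n. \<tau> n \<omega> \<le> t} \<le> 0"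
  proof (rule LIMSEQ_le_const[OF prob_tau_le_const_tendsto_0[of t]])
    show "\<exists>N. \<forall>n\<ge>N. prob {\<omega>\<in>space M. \<forall>n. \<tau> n \<omega> \<le> t} \<le> prob {\<omega>\<in>space M. \<tau> n \<omega> \<le> t}"
      by (intro exI allI impI finite_measure_mono) auto
  qed
  then have "prob {\<omega>\<in>space M. \<forall>n. \<tau> n \<omega> \<le> t} = 0" by (simp add: measure_le_0_iff)
  then have "AE \<omega> in M. \<not> (\<forall>n. \<tau> n \<omega> \<le> t)"
    by (subst prob_Collect_eq_0[symmetric]) auto
  with AE_space show "AE \<omega> in M. \<omega> \<in> {\<omega>\<in>space M. crossing_time T Y u c \<omega> \<le> ereal t} \<longleftrightarrow> \<omega> \<in> crossing t u"
  proof eventually_elim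
    case (elim \<omega>)
    have pos: "T i \<omega> > 0" for i using T_pos elim(1) .
    obtain N where N: "\<tau> N \<omega> > t" using elim(2) by (auto simp: not_le)
    have "(\<exists>s. 0 < s \<and> s \<le> t \<and> ?V s \<omega> - c * s > u) \<longleftrightarrow> (\<exists>n\<ge>1. \<tau> n \<omega> \<le> t \<and> S n \<omega> > u)"
    proof
      assume "\<exists>s. 0 < s \<and> s \<le> t \<and> ?V s \<omega> - c * s > u"
      then obtain s where s: "0 < s" "s \<le> t" "?V s \<omega> - c * s > u" by blast
      have cs: "c * s > 0" using c_pos s(1) by simp
      let ?K = "{n. n \<ge> 1 \<and> \<tau> n \<omega> \<le> s}"
      \<comment> \<open>Before the first renewal the process is \<open>- c * s\<close>, which is
        negative and cannot exceed \<open>u \<ge> 0\<close>.\<close>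
      have T0: "\<not> T 0 \<omega> > s"
      proof
        assume "T 0 \<omega> > s"
        then have "?V s \<omega> = 0" by (simp add: compound_renewal_def renewal_count_def)
        then show False using s(3) u cs by simp
      qed
      have "?K \<subseteq> {..<N}"
      proof
        fix n assume "n \<in> ?K"
        then have "\<tau> n \<omega> < \<tau> N \<omega>" using N s(2) by simp
        then show "n \<in> {..<N}" using tau_mono[OF elim(1), of N n] by (meson lessThan_iff not_le)
      qed
      then have fin: "finite ?K" by (rule finite_subset) simp
      have "1 \<in> ?K" using T0 by simp
      then have "Max ?K \<in> ?K" using fin by (intro Max_in) auto
      moreover have "renewal_count T s \<omega> = Max ?K" using T0 by (simp add: renewal_count_def)
      ultimately have n: "renewal_count T s \<omega> \<ge> 1" "\<tau> (renewal_count T s \<omega>) \<omega> \<le> s" by auto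
      have "S (renewal_count T s \<omega>) \<omega> = ?V s \<omega> - c * \<tau> (renewal_count T s \<omega>) \<omega>"
        by (simp add: X_def compound_renewal_def sum_subtractf sum_distrib_left)
      also have "\<dots> \<ge> ?V s \<omega> - c * s" using n(2) c_pos by (simp add: mult_left_mono)
      finally have "S (renewal_count T s \<omega>) \<omega> > u" using s(3) by linarith
      then show "\<exists>n\<ge>1. \<tau> n \<omega> \<le> t \<and> S n \<omega> > u"
        using n s(2) by (intro exI[of _ "renewal_count T s \<omega>"]) auto
    next
      assume "\<exists>n\<ge>1. \<tau> n \<omega> \<le> t \<and> S n \<omega> > u"
      then obtain n where n: "n \<ge> 1" "\<tau> n \<omega> \<le> t" "S n \<omega> > u" by blast
      have "\<tau> n \<omega> > 0" using n(1) pos by (intro sum_pos) (auto simp: lessThan_empty_iff)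
      moreover have "?V (\<tau> n \<omega>) \<omega> - c * \<tau> n \<omega> = S n \<omega>"
        by (simp add: compound_renewal_def renewal_count_at_renewal[of T \<omega> n, OF pos n(1)] X_def sum_subtractf sum_distrib_left)
      ultimately show "\<exists>s. 0 < s \<and> s \<le> t \<and> ?V s \<omega> - c * s > u"
        using n by (intro exI[of _ "\<tau> n \<omega>"]) auto
    qed
    then show ?case using iff[OF elim(1)] elim(1) by (simp add: crossing_def)
  qed
qed simp

text \<open>Continuity gives a solution between the two levels, monotonicity keeps all others there
  as well, and strictness on this range makes it unique, which determines the definite
  description.\<close>

lemma eventually_fixed_prob_level:
  assumes \<alpha>: "0 < \<alpha>" "\<alpha> < 1 / 2" and y: "0 < y" "y < z"
    and yz: "\<alpha> < 2 * normal_tail (y * sqrt \<mu> / \<sigma>)" "2 * normal_tail (z * sqrt \<mu> / \<sigma>) < \<alpha>"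
  shows "eventually (\<lambda>t. fixed_prob_level M T Y \<alpha> t c \<in> {y * sqrt t .. z * sqrt t}) at_top"
proof -
  obtain K B where strict: "\<forall>t u u'. K \<le> u \<longrightarrow> u < u' \<longrightarrow> B * (u' + 1) \<le> t \<longrightarrow> prob (crossing t u') < prob (crossing t u)"
    by (rule prob_crossing_strict) blast
  have z: "z > 0" using y by simp
  have "eventually (\<lambda>t. K \<le> y * sqrt t) at_top"
    using y(1) by real_asymp
  moreover have "eventually (\<lambda>t. B * (z * sqrt t + 1) \<le> t) at_top"
    by real_asymp
  moreover have "eventually (\<lambda>t :: real. t > 0) at_top" by (rule eventually_gt_at_top)
  moreover have "eventually (\<lambda>t. \<alpha> < prob (crossing t (y * sqrt t))) at_top"
    by (rule eventually_prob_crossing_greater[OF y(1) yz(1)])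
  moreover have "eventually (\<lambda>t. prob (crossing t (z * sqrt t)) < \<alpha>) at_top"
    by (rule eventually_prob_crossing_less[OF z yz(2)])
  ultimately show ?thesis
  proof eventually_elim
    case (elim t)
    let ?a = "y * sqrt t" and ?b = "z * sqrt t"
    have ab: "0 \<le> ?a" "?a \<le> ?b" using y elim(3) by (auto intro: mult_right_mono)
    have "\<exists>u\<ge>?a. u \<le> ?b \<and> prob (crossing t u) = \<alpha>"
      by (rule IVT2) (use elim ab isCont_prob_crossing in auto)
    then obtain u where u: "?a \<le> u" "u \<le> ?b" "prob (crossing t u) = \<alpha>" by blast
    have unique: "w = u" if w: "w \<ge> 0" "prob (crossing t w) = \<alpha>" for w
    proof -
      have "w \<le> ?b"
        using prob_crossing_antimono[of ?b w t] elim(5) w(2) by (cases "w \<le> ?b") auto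
      moreover have "?a \<le> w"
        using prob_crossing_antimono[of w ?a t] elim(4) w(2) by (cases "?a \<le> w") auto
      moreover have "prob (crossing t v') < prob (crossing t v)" if "?a \<le> v" "v < v'" "v' \<le> ?b" for v v'
      proof -
        have "B * (v' + 1) \<le> t"
        \<comment> \<open>The sign of \<open>B\<close> is not part of what was obtained; for
          negative \<open>B\<close> the condition is trivial as \<open>t > 0\<close>.\<close>
        proof (cases "B \<ge> 0")
          case True
          then have "B * (v' + 1) \<le> B * (?b + 1)" using that by (intro mult_left_mono) auto
          then show ?thesis using elim(2) by simp
        next
          case False
          then have "B * (v' + 1) \<le> 0" using that ab by (intro mult_nonpos_nonneg) auto
          then show ?thesis using elim(3) by simp
        qed
        then show ?thesis using strict that elim(1) by (meson order.trans)
      qed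
      ultimately show ?thesis using u w(2) by (metis less_irrefl linorder_less_linear)
    qed
    have "fixed_prob_level M T Y \<alpha> t c = u"
      unfolding fixed_prob_level_def
    proof (rule the_equality)
      show "u \<ge> 0 \<and> prob {\<omega>\<in>space M. crossing_time T Y u c \<omega> \<le> ereal t} = \<alpha>"
        using u ab elim(3) prob_crossing_time_le[of t u] by simp
      show "w = u" if "w \<ge> 0 \<and> prob {\<omega>\<in>space M. crossing_time T Y w c \<omega> \<le> ereal t} = \<alpha>" for w
        using that elim(3) prob_crossing_time_le[of t w] by (intro unique) auto
    qed
    then show ?case using u by simp
  qed
qed

lemma fixed_prob_level_asymp:
  assumes \<alpha>: "0 < \<alpha>" "\<alpha> < 1 / 2"
  shows "(\<lambda>t. fixed_prob_level M T Y \<alpha> t c) \<sim>[at_top] (\<lambda>t. \<sigma> / sqrt \<mu> * normal_upper_quantile (\<alpha> / 2) * sqrt t)"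
proof -
  let ?\<kappa> = "normal_upper_quantile (\<alpha> / 2)"
  have \<kappa>: "normal_tail ?\<kappa> = \<alpha> / 2" "?\<kappa> > 0"
    using normal_upper_quantile[of "\<alpha> / 2"] \<alpha> by auto
  have \<mu>: "\<mu> > 0" by (rule expectation_pos)
  \<comment> \<open>The root \<open>y\<close> of
    \<open>2 * normal_tail (y * sqrt \<mu> / \<sigma>) = \<alpha>\<close>, the limiting equation for
    the level divided by \<open>sqrt t\<close>.\<close>
  define y0 where "y0 = \<sigma> / sqrt \<mu> * ?\<kappa>"
  have y0: "y0 > 0" using \<mu> \<kappa> sigma_pos by (simp add: y0_def)
  have y0': "y0 * sqrt \<mu> / \<sigma> = ?\<kappa>" using \<mu> sigma_pos by (simp add: y0_def)
  have tail: "2 * normal_tail (z * sqrt \<mu> / \<sigma>) < \<alpha>" if "z > y0" for z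
  proof -
    have "?\<kappa> < z * sqrt \<mu> / \<sigma>" unfolding y0'[symmetric] using that \<mu> sigma_pos
      by (intro divide_strict_right_mono mult_strict_right_mono) auto
    then show ?thesis using cdf_std_normal_strict_mono \<kappa>(1) by force
  qed
  have tail': "\<alpha> < 2 * normal_tail (z * sqrt \<mu> / \<sigma>)" if "z < y0" for z
  proof -
    have "z * sqrt \<mu> / \<sigma> < ?\<kappa>" unfolding y0'[symmetric] using that \<mu> sigma_pos
      by (intro divide_strict_right_mono mult_strict_right_mono) auto
    then show ?thesis using cdf_std_normal_strict_mono \<kappa>(1) by force
  qed
  have "((\<lambda>t. fixed_prob_level M T Y \<alpha> t c / sqrt t) \<longlongrightarrow> y0) at_top"
  proof (rule order_tendstoI)
    fix a assume "a < y0"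
    then obtain y where y: "max a 0 < y" "y < y0" using dense[of "max a 0" y0] y0 by auto
    \<comment> \<open>Only the lower end matters for this half; \<open>y0 + 1\<close> is any value
      above \<open>y0\<close>.\<close>
    have "eventually (\<lambda>t. fixed_prob_level M T Y \<alpha> t c \<in> {y * sqrt t .. (y0 + 1) * sqrt t}) at_top"
      by (rule eventually_fixed_prob_level[OF \<alpha>]) (use y y0 tail[of "y0 + 1"] tail'[OF y(2)] in auto)
    then show "eventually (\<lambda>t. a < fixed_prob_level M T Y \<alpha> t c / sqrt t) at_top"
      using eventually_gt_at_top[of 0]
    proof eventually_elim
      case (elim t)
      then have "y \<le> fixed_prob_level M T Y \<alpha> t c / sqrt t" by (simp add: pos_le_divide_eq)
      then show ?case using y by simp
    qed
  next
    fix a assume "y0 < a"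
    then obtain z where z: "y0 < z" "z < a" using dense by auto
    have "eventually (\<lambda>t. fixed_prob_level M T Y \<alpha> t c \<in> {y0 / 2 * sqrt t .. z * sqrt t}) at_top"
      by (rule eventually_fixed_prob_level[OF \<alpha>]) (use y0 z tail[OF z(1)] tail'[of "y0 / 2"] in auto)
    then show "eventually (\<lambda>t. fixed_prob_level M T Y \<alpha> t c / sqrt t < a) at_top"
      using eventually_gt_at_top[of 0]
    proof eventually_elim
      case (elim t)
      then have "fixed_prob_level M T Y \<alpha> t c / sqrt t \<le> z" by (simp add: pos_divide_le_eq)
      then show ?case using z by simp
    qed
  qed
  then have "((\<lambda>t. fixed_prob_level M T Y \<alpha> t c / sqrt t / y0) \<longlongrightarrow> y0 / y0) at_top"
    by (intro tendsto_divide tendsto_const) (use y0 in auto)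
  then have "((\<lambda>t. fixed_prob_level M T Y \<alpha> t c / (y0 * sqrt t)) \<longlongrightarrow> 1) at_top"
    using y0 by (simp add: mult.commute)
  then show ?thesis unfolding y0_def[symmetric] by (rule asymp_equivI')
qed

text \<open>Both sides are positive, so it suffices to compare squares:
  \<open>D\<^sup>2 / M ^ 3\<close> is the variance of a step divided by \<mu>.\<close>

lemma sigma_over_sqrt_mean:
  assumes "D > 0" "D\<^sup>2 = D_squared M (T 0) (Y 0)"
  shows "D / mean_ratio M (T 0) (Y 0) powr (3 / 2) = \<sigma> / sqrt \<mu>"
proof -
  let ?M = "mean_ratio M (T 0) (Y 0)" and ?m = "expectation (Y 0)"
  have pos: "\<mu> > 0" "?m > 0" by (rule expectation_pos)+
  then have M: "?M > 0" by (simp add: mean_ratio_def)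
  have "(D / ?M powr (3 / 2))\<^sup>2 = D\<^sup>2 / ?M ^ 3"
  proof -
    have "(?M powr (3 / 2))\<^sup>2 = ?M ^ 3"
      using M by (simp add: powr_power powr_numeral)
    then show ?thesis by (simp add: power_divide)
  qed
  also have "\<dots> = (variance (Y 0) + c\<^sup>2 * variance (T 0)) / \<mu>"
    unfolding assms(2) D_squared_def mean_ratio_def c_def
    using pos by (simp add: field_simps power2_eq_square power3_eq_cube)
  also have "\<dots> = (\<sigma> / sqrt \<mu>)\<^sup>2"
    using pos expectation_X_square variance by (simp add: power_divide)
  finally show ?thesis
    using assms(1) M pos sigma_pos by (subst (asm) power2_eq_iff_nonneg) auto
qed

end

theorem theorem6p2:
  fixes \<Omega> :: "'a measure"
    and T Y :: "nat \<Rightarrow> 'a \<Rightarrow> real"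
    and f_T f_Y :: "real \<Rightarrow> real"
    and \<alpha> M c_star D :: real
  assumes "prob_space \<Omega>"
    and "\<And>i \<omega>. \<omega> \<in> space \<Omega> \<Longrightarrow> 0 < T i \<omega>"
    and "\<And>i \<omega>. \<omega> \<in> space \<Omega> \<Longrightarrow> 0 < Y i \<omega>"
    and "\<And>x. 0 \<le> f_T x"
    and "\<And>x. 0 \<le> f_Y x"
    and "\<And>i. distributed \<Omega> lborel (T i) (\<lambda>x. ennreal (f_T x))"
    and "\<And>i. distributed \<Omega> lborel (Y i) (\<lambda>x. ennreal (f_Y x))"
    and "prob_space.indep_vars \<Omega> (\<lambda>_. borel) T UNIV"
    and "prob_space.indep_vars \<Omega> (\<lambda>_. borel) Y UNIV"
    and "prob_space.indep_var \<Omega>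
           (Pi\<^sub>M UNIV (\<lambda>_. borel)) (\<lambda>\<omega> i. T i \<omega>) (Pi\<^sub>M UNIV (\<lambda>_. borel)) (\<lambda>\<omega> i. Y i \<omega>)"
    and "\<exists>C. \<forall>x. f_T x \<le> C"
    and "\<exists>C. \<forall>x. f_Y x \<le> C"
    and "integrable \<Omega> (\<lambda>\<omega>. T 0 \<omega> ^ 3)"
    and "integrable \<Omega> (\<lambda>\<omega>. Y 0 \<omega> ^ 3)"
    and "0 < \<alpha>" and "\<alpha> < 1 / 2"
    and "M = mean_ratio \<Omega> (T 0) (Y 0)"
    and "c_star = 1 / M"
    and "D\<^sup>2 = D_squared \<Omega> (T 0) (Y 0)" and "D > 0"
  shows "(\<lambda>t. fixed_prob_level \<Omega> T Y \<alpha> t c_star)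
           \<sim>[at_top] (\<lambda>t. D / M powr (3 / 2) * normal_upper_quantile (\<alpha> / 2) * sqrt t)"
proof -
  interpret prob_space \<Omega> by (rule assms(1))
  interpret claims_process \<Omega> T Y f_T f_Y
    by unfold_locales (use assms in auto)
  have "c_star = c"
    by (simp add: assms(17,18) mean_ratio_def c_def)
  moreover have "D / M powr (3 / 2) = \<sigma> / sqrt (expectation (T 0))"
    unfolding assms(17) by (rule sigma_over_sqrt_mean) (use assms in auto)
  ultimately show ?thesis
    using fixed_prob_level_asymp[OF assms(15,16)] by simp
qed

end
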